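(* Let $\{\mathcal G,\Gamma_0,\Gamma_1\}$ be a quasi boundary triple for $T\subset A^*$ with $A_0=T\upharpoonright\ker\Gamma_0$, and assume that $\mathscr G_1:=\operatorname{ran}(\Gamma_1\upharpoonright\ker\Gamma_0)$ is dense in $\mathcal G$. Then for any norm $\|\cdot\|_{\mathscr G_1}$ on $\mathscr G_1$ such that (i) $(\mathscr G_1,\|\cdot\|_{\mathscr G_1})$ is a reflexive Banach space continuously embedded in $\mathcal G$, and (ii) the operator $\Gamma_1(A_0-\bar\lambda)^{-1}:\mathcal H\to\mathscr G_1$ is continuous for some, and hence for all, $\lambda\in\rho(A_0)$, the boundary mapping $\Gamma_0$ admits a unique surjective, continuous extension $$\widetilde\Gamma_0:(\operatorname{dom}A^*,\|\cdot\|_{A^*})\to\mathscr G_1',$$ where $\mathscr G_1'$ is the anti-dual space of $\mathscr G_1$. Moreover, the norm induced by the inner product $$(\Lambda^{-1/2}x,\Lambda^{-1/2}y)_{\mathcal G},\qquad x,y\in\mathscr G_1,\qquad \Lambda:=\overline{\operatorname{Im}M(i)},$$ is equivalent to any norm $\|\cdot\|_{\mathscr G_1}$ on $\mathscr G_1$ with the properties (i)-(ii).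
   Context: Inner products are linear in the first and antilinear in the second argument. $\mathcal H$ is a separable Hilbert space, $A$ is a closed, densely defined, symmetric operator in $\mathcal H$ with adjoint $A^*$, and $\|\cdot\|_{A^*}$ is the graph norm of $A^*$. Quasi boundary triple: let $T\subset A^*$ be a linear operator in $\mathcal H$ with $\overline T=A^*$. A triple $\{\mathcal G,\Gamma_0,\Gamma_1\}$ is a quasi boundary triple for $T\subset A^*$ if $\mathcal G$ is a Hilbert space and $\Gamma_0,\Gamma_1:\operatorname{dom}T\to\mathcal G$ are linear maps such that (a) $(Tf,g)_{\mathcal H}-(f,Tg)_{\mathcal H}=(\Gamma_1f,\Gamma_0g)_{\mathcal G}-(\Gamma_0f,\Gamma_1g)_{\mathcal G}$ for all $f,g\in\operatorname{dom}T$; (b) $\Gamma=(\Gamma_0,\Gamma_1)^\top:\operatorname{dom}T\to\mathcal G\times\mathcal G$ has dense range; (c) $A_0:=T\upharpoonright\ker\Gamma_0$ is self-adjoint in $\mathcal H$. For $\lambda\in\rho(A_0)$ one has $\operatorname{dom}T=\operatorname{dom}A_0\,\dot{+}\,\ker(T-\lambda)$, and one sets $\gamma(\lambda):=(\Gamma_0\upharpoonright\ker(T-\lambda))^{-1}$ ($\gamma$-field) and $M(\lambda):=\Gamma_1\gamma(\lambda)$ (Weyl function), both defined on the dense subspace $\operatorname{ran}\Gamma_0$ of $\mathcal G$. The operator $\operatorname{Im}M(\lambda):=\frac1{2i}(M(\lambda)-M(\lambda)^* )$, defined on $\operatorname{ran}\Gamma_0$, is bounded in $\mathcal G$; the closure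 $\Lambda=\overline{\operatorname{Im}M(i)}$ is a bounded non-negative self-adjoint operator on $\mathcal G$. If $\mathscr G_1$ is dense in $\mathcal G$, then $\Lambda$ is injective and $\mathscr G_1=\operatorname{ran}\Lambda^{1/2}$. The anti-dual $\mathscr G_1'$ is the space of continuous antilinear functionals on $\mathscr G_1$; $\mathcal G$ is regarded as a subspace of $\mathscr G_1'$ via the inner product of $\mathcal G$, so that the pairing $\langle\cdot,\cdot\rangle_{\mathscr G_1'\times\mathscr G_1}$ extends $(\cdot,\cdot)_{\mathcal G}$. *)

theory Defs
  imports "HOL-Analysis.Analysis" "HOL-Library.Function_Algebras"
begin

section \<open>Complex vector spaces and complex Hilbert spaces\<close>

class scaleC =
  fixes scaleC :: "complex \<Rightarrow> 'a \<Rightarrow> 'a" (infixr "*\<^sub>C" 75)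

class complex_vector = scaleC + ab_group_add +
  assumes scaleC_add_right: "a *\<^sub>C (x + y) = a *\<^sub>C x + a *\<^sub>C y"
    and scaleC_add_left: "(a + b) *\<^sub>C x = a *\<^sub>C x + b *\<^sub>C x"
    and scaleC_scaleC: "a *\<^sub>C (b *\<^sub>C x) = (a * b) *\<^sub>C x"
    and scaleC_one: "1 *\<^sub>C x = x"

global_interpretation complex_vector: vector_space "scaleC :: complex \<Rightarrow> 'a \<Rightarrow> 'a::complex_vector"
  by standard (fact scaleC_add_right scaleC_add_left scaleC_scaleC scaleC_one)+

instantiation complex :: complex_vector
begin
definition scaleC_complex :: "complex \<Rightarrow> complex \<Rightarrow> complex" where
  "scaleC_complex a x = a * x"
instance by standard (simp_all add: scaleC_complex_def algebra_simps)
end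

instantiation prod :: (complex_vector, complex_vector) complex_vector
begin
definition scaleC_prod :: "complex \<Rightarrow> 'a \<times> 'b \<Rightarrow> 'a \<times> 'b" where
  "scaleC_prod a p = (a *\<^sub>C fst p, a *\<^sub>C snd p)"
instance
  by standard
    (auto simp: scaleC_prod_def prod_eq_iff scaleC_add_right scaleC_add_left scaleC_scaleC scaleC_one)
end

instantiation "fun" :: (type, complex_vector) complex_vector
begin
definition scaleC_fun :: "complex \<Rightarrow> ('a \<Rightarrow> 'b) \<Rightarrow> 'a \<Rightarrow> 'b" where
  "scaleC_fun a f = (\<lambda>x. a *\<^sub>C f x)"
instance
  by standard
    (auto simp: scaleC_fun_def fun_eq_iff scaleC_add_right scaleC_add_left scaleC_scaleC scaleC_one)
end

text \<open>The inner product is linear in the first and antilinear in the second argument.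
  Completeness is part of the class \<^class>\<open>banach\<close>; the real scalar
  multiplication, the norm and the topology are those determined by the complex structure.\<close>

class chilbert_space = complex_vector + banach +
  fixes cinner :: "'a \<Rightarrow> 'a \<Rightarrow> complex"
  assumes scaleR_scaleC: "scaleR r x = of_real r *\<^sub>C x"
    and cinner_commute: "cinner x y = cnj (cinner y x)"
    and cinner_add_left: "cinner (x + y) z = cinner x z + cinner y z"
    and cinner_scaleC_left: "cinner (a *\<^sub>C x) y = a * cinner x y"
    and cinner_self_eq_norm: "cinner x x = of_real ((norm x)\<^sup>2)"

instantiation complex :: chilbert_space
begin
definition cinner_complex :: "complex \<Rightarrow> complex \<Rightarrow> complex" where
  "cinner_complex x y = x * cnj y"
instance
  by standard
    (simp_all add: cinner_complex_def scaleC_complex_def algebra_simps scaleR_conv_of_real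
      complex_norm_square[symmetric])
end


section \<open>Linear and antilinear maps, norms on a subspace\<close>

abbreviation csubspace :: "'a::complex_vector set \<Rightarrow> bool" where
  "csubspace \<equiv> complex_vector.subspace"

definition clinear_on ::
    "'a::complex_vector set \<Rightarrow> ('a \<Rightarrow> 'b::complex_vector) \<Rightarrow> bool" where
  "clinear_on V f \<longleftrightarrow>
     (\<forall>x\<in>V. \<forall>y\<in>V. f (x + y) = f x + f y) \<and> (\<forall>a. \<forall>x\<in>V. f (a *\<^sub>C x) = a *\<^sub>C f x)"

definition antilinear_on ::
    "'a::complex_vector set \<Rightarrow> ('a \<Rightarrow> 'b::complex_vector) \<Rightarrow> bool" where
  "antilinear_on V f \<longleftrightarrow>
     (\<forall>x\<in>V. \<forall>y\<in>V. f (x + y) = f x + f y) \<and> (\<forall>a. \<forall>x\<in>V. f (a *\<^sub>C x) = cnj a *\<^sub>C f x)"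

text \<open>A normed space is given by a carrier \<open>V\<close> and a function \<open>n\<close>, of which only the values
  on \<open>V\<close> matter.\<close>

definition is_norm_on :: "'a::complex_vector set \<Rightarrow> ('a \<Rightarrow> real) \<Rightarrow> bool" where
  "is_norm_on V n \<longleftrightarrow>
     (\<forall>x\<in>V. 0 \<le> n x \<and> (n x = 0 \<longrightarrow> x = 0)) \<and>
     (\<forall>a. \<forall>x\<in>V. n (a *\<^sub>C x) = cmod a * n x) \<and>
     (\<forall>x\<in>V. \<forall>y\<in>V. n (x + y) \<le> n x + n y)"

definition complete_norm_on :: "'a::complex_vector set \<Rightarrow> ('a \<Rightarrow> real) \<Rightarrow> bool" where
  "complete_norm_on V n \<longleftrightarrow>
     (\<forall>X :: nat \<Rightarrow> 'a. (\<forall>k. X k \<in> V) \<and> (\<forall>e>0. \<exists>K. \<forall>i\<ge>K. \<forall>j\<ge>K. n (X i - X j) < e)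
        \<longrightarrow> (\<exists>x\<in>V. (\<lambda>k. n (X k - x)) \<longlonglongrightarrow> 0))"

definition norm_continuous_on ::
    "'a::complex_vector set \<Rightarrow> ('a \<Rightarrow> real) \<Rightarrow> ('b::complex_vector \<Rightarrow> real) \<Rightarrow> ('a \<Rightarrow> 'b) \<Rightarrow> bool" where
  "norm_continuous_on V n m f \<longleftrightarrow>
     (\<forall>x\<in>V. \<forall>e>0. \<exists>d>0. \<forall>y\<in>V. n (y - x) < d \<longrightarrow> m (f y - f x) < e)"

definition equivalent_norms_on ::
    "'a set \<Rightarrow> ('a \<Rightarrow> real) \<Rightarrow> ('a \<Rightarrow> real) \<Rightarrow> bool" where
  "equivalent_norms_on V n m \<longleftrightarrow>
     (\<exists>c>0. \<exists>C>0. \<forall>x\<in>V. c * n x \<le> m x \<and> m x \<le> C * n x)"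

definition induced_norm :: "('a \<Rightarrow> 'a \<Rightarrow> complex) \<Rightarrow> 'a \<Rightarrow> real" where
  "induced_norm ip x = sqrt (Re (ip x x))"


section \<open>Dual, anti-dual and reflexivity\<close>

text \<open>A functional on \<open>V\<close> is represented by the function that vanishes outside \<open>V\<close>; pointwise
  operations then are the vector space operations of the (anti-)dual.\<close>

definition dual ::
    "'a::complex_vector set \<Rightarrow> ('a \<Rightarrow> real) \<Rightarrow> ('a \<Rightarrow> complex) set" where
  "dual V n = {\<phi>. clinear_on V \<phi> \<and> norm_continuous_on V n cmod \<phi> \<and> (\<forall>x. x \<notin> V \<longrightarrow> \<phi> x = 0)}"

definition antidual ::
    "'a::complex_vector set \<Rightarrow> ('a \<Rightarrow> real) \<Rightarrow> ('a \<Rightarrow> complex) set" where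
  "antidual V n =
     {\<phi>. antilinear_on V \<phi> \<and> norm_continuous_on V n cmod \<phi> \<and> (\<forall>x. x \<notin> V \<longrightarrow> \<phi> x = 0)}"

definition functional_norm ::
    "'a set \<Rightarrow> ('a \<Rightarrow> real) \<Rightarrow> ('a \<Rightarrow> complex) \<Rightarrow> real" where
  "functional_norm V n \<phi> = (SUP x\<in>{x \<in> V. n x \<le> 1}. cmod (\<phi> x))"

definition reflexive_on :: "'a::complex_vector set \<Rightarrow> ('a \<Rightarrow> real) \<Rightarrow> bool" where
  "reflexive_on V n \<longleftrightarrow>
     (\<forall>\<Phi> \<in> dual (dual V n) (functional_norm V n). \<exists>x\<in>V. \<forall>\<phi>\<in>dual V n. \<Phi> \<phi> = \<phi> x)"

definition reflexive_banach_on :: "'a::complex_vector set \<Rightarrow> ('a \<Rightarrow> real) \<Rightarrow> bool" where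
  "reflexive_banach_on V n \<longleftrightarrow>
     csubspace V \<and> is_norm_on V n \<and> complete_norm_on V n \<and> reflexive_on V n"

text \<open>The element of the anti-dual of \<open>V\<close> with which \<open>x\<close> is identified.\<close>

definition antidual_embed :: "'a::chilbert_space set \<Rightarrow> 'a \<Rightarrow> 'a \<Rightarrow> complex" where
  "antidual_embed V x = (\<lambda>y. if y \<in> V then cinner x y else 0)"


section \<open>Unbounded operators\<close>

text \<open>Operators are identified with their graphs. Hence inclusion of operators is \<open>\<subseteq>\<close>, the domain
  is \<^const>\<open>Domain\<close>, closedness and closure are those of the graph in the product space, the
  product \<open>R S\<close> is \<open>S O R\<close>, and the inverse of an injective operator is \<^const>\<open>converse\<close>.\<close>

type_synonym ('a, 'b) graph = "('a \<times> 'b) set"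

definition linear_operator :: "('a::complex_vector, 'b::complex_vector) graph \<Rightarrow> bool" where
  "linear_operator S \<longleftrightarrow> csubspace S \<and> single_valued S"

definition app :: "('a, 'b) graph \<Rightarrow> 'a \<Rightarrow> 'b" where
  "app S f = (THE g. (f, g) \<in> S)"

definition densely_defined :: "('a::topological_space, 'b) graph \<Rightarrow> bool" where
  "densely_defined S \<longleftrightarrow> closure (Domain S) = UNIV"

definition adjoint_op ::
    "('a::chilbert_space, 'b::chilbert_space) graph \<Rightarrow> ('b, 'a) graph" where
  "adjoint_op S = {(g, g'). \<forall>(f, f') \<in> S. cinner f' g = cinner f g'}"

definition symmetric_op :: "('a::chilbert_space, 'a) graph \<Rightarrow> bool" where
  "symmetric_op S \<longleftrightarrow> (\<forall>(f, f') \<in> S. \<forall>(g, g') \<in> S. cinner f' g = cinner f g')"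

definition self_adjoint :: "('a::chilbert_space, 'a) graph \<Rightarrow> bool" where
  "self_adjoint S \<longleftrightarrow> linear_operator S \<and> densely_defined S \<and> adjoint_op S = S"

definition nonnegative_op :: "('a::chilbert_space, 'a) graph \<Rightarrow> bool" where
  "nonnegative_op S \<longleftrightarrow> (\<forall>(f, f') \<in> S. Im (cinner f' f) = 0 \<and> 0 \<le> Re (cinner f' f))"

text \<open>The unique non-negative self-adjoint square root of a non-negative self-adjoint operator.\<close>

definition sqrt_op :: "('a::chilbert_space, 'a) graph \<Rightarrow> ('a, 'a) graph" where
  "sqrt_op S = (THE R. self_adjoint R \<and> nonnegative_op R \<and> R O R = S)"

definition imag_part_op :: "('a::chilbert_space, 'a) graph \<Rightarrow> ('a, 'a) graph" where
  "imag_part_op S =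
     {(x, (1 / (2 * \<i>)) *\<^sub>C (y - y')) | x y y'. (x, y) \<in> S \<and> (x, y') \<in> adjoint_op S}"

definition graph_norm :: "('a::real_normed_vector, 'b::real_normed_vector) graph \<Rightarrow> 'a \<Rightarrow> real" where
  "graph_norm S f = sqrt ((norm f)\<^sup>2 + (norm (app S f))\<^sup>2)"

definition resolvent :: "('a::chilbert_space, 'a) graph \<Rightarrow> complex \<Rightarrow> 'a \<Rightarrow> 'a" where
  "resolvent S \<mu> = the_inv_into (Domain S) (\<lambda>f. app S f - \<mu> *\<^sub>C f)"

definition resolvent_set :: "('a::chilbert_space, 'a) graph \<Rightarrow> complex set" where
  "resolvent_set S =
     {\<mu>. bij_betw (\<lambda>f. app S f - \<mu> *\<^sub>C f) (Domain S) UNIV \<and> continuous_on UNIV (resolvent S \<mu>)}"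

definition eigenspace :: "('a::complex_vector, 'a) graph \<Rightarrow> complex \<Rightarrow> 'a set" where
  "eigenspace S \<mu> = {f \<in> Domain S. app S f = \<mu> *\<^sub>C f}"


section \<open>Quasi boundary triples\<close>

text \<open>The boundary maps are total functions, of which only the values on \<open>Domain T\<close> matter.\<close>

definition ker_on :: "('a, 'b) graph \<Rightarrow> ('a \<Rightarrow> 'c::zero) \<Rightarrow> 'a set" where
  "ker_on T \<Gamma> = {f \<in> Domain T. \<Gamma> f = 0}"

definition restrict_to_ker :: "('a, 'b) graph \<Rightarrow> ('a \<Rightarrow> 'c::zero) \<Rightarrow> ('a, 'b) graph" where
  "restrict_to_ker T \<Gamma> = {(f, g) \<in> T. f \<in> ker_on T \<Gamma>}"

definition quasi_boundary_triple ::
    "('h::chilbert_space, 'h) graph \<Rightarrow> ('h, 'h) graph \<Rightarrow>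
     ('h \<Rightarrow> 'g::chilbert_space) \<Rightarrow> ('h \<Rightarrow> 'g) \<Rightarrow> bool" where
  "quasi_boundary_triple A T \<Gamma>0 \<Gamma>1 \<longleftrightarrow>
     linear_operator T \<and> T \<subseteq> adjoint_op A \<and> closure T = adjoint_op A \<and>
     clinear_on (Domain T) \<Gamma>0 \<and> clinear_on (Domain T) \<Gamma>1 \<and>
     (\<forall>f\<in>Domain T. \<forall>g\<in>Domain T.
        cinner (app T f) g - cinner f (app T g) = cinner (\<Gamma>1 f) (\<Gamma>0 g) - cinner (\<Gamma>0 f) (\<Gamma>1 g)) \<and>
     closure ((\<lambda>f. (\<Gamma>0 f, \<Gamma>1 f)) ` Domain T) = UNIV \<and>
     self_adjoint (restrict_to_ker T \<Gamma>0)"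

definition gamma_field ::
    "('h::chilbert_space, 'h) graph \<Rightarrow> ('h \<Rightarrow> 'g) \<Rightarrow> complex \<Rightarrow> 'g \<Rightarrow> 'h" where
  "gamma_field T \<Gamma>0 \<mu> = the_inv_into (eigenspace T \<mu>) \<Gamma>0"

definition weyl_function ::
    "('h::chilbert_space, 'h) graph \<Rightarrow> ('h \<Rightarrow> 'g) \<Rightarrow> ('h \<Rightarrow> 'g) \<Rightarrow> complex \<Rightarrow> ('g, 'g) graph" where
  "weyl_function T \<Gamma>0 \<Gamma>1 \<mu> = {(x, \<Gamma>1 (gamma_field T \<Gamma>0 \<mu> x)) | x. x \<in> \<Gamma>0 ` Domain T}"

definition Lambda_op ::
    "('h::chilbert_space, 'h) graph \<Rightarrow> ('h \<Rightarrow> 'g::chilbert_space) \<Rightarrow> ('h \<Rightarrow> 'g) \<Rightarrow> ('g, 'g) graph" where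
  "Lambda_op T \<Gamma>0 \<Gamma>1 = closure (imag_part_op (weyl_function T \<Gamma>0 \<Gamma>1 \<i>))"

definition Lambda_inner ::
    "('h::chilbert_space, 'h) graph \<Rightarrow> ('h \<Rightarrow> 'g::chilbert_space) \<Rightarrow> ('h \<Rightarrow> 'g) \<Rightarrow>
     'g \<Rightarrow> 'g \<Rightarrow> complex" where
  "Lambda_inner T \<Gamma>0 \<Gamma>1 x y =
     (let R = (sqrt_op (Lambda_op T \<Gamma>0 \<Gamma>1))\<inverse> in cinner (app R x) (app R y))"

text \<open>Continuous maps \<open>F\<close> from the domain of the adjoint of \<open>A\<close>, with its graph norm, to the
  anti-dual of \<open>(V, n)\<close> that extend \<open>\<Gamma>0\<close>.\<close>

definition continuous_extension ::
    "('h::chilbert_space, 'h) graph \<Rightarrow> ('h, 'h) graph \<Rightarrow> ('h \<Rightarrow> 'g::chilbert_space) \<Rightarrow>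
     'g set \<Rightarrow> ('g \<Rightarrow> real) \<Rightarrow> ('h \<Rightarrow> 'g \<Rightarrow> complex) \<Rightarrow> bool" where
  "continuous_extension A T \<Gamma>0 V n F \<longleftrightarrow>
     F ` Domain (adjoint_op A) \<subseteq> antidual V n \<and>
     norm_continuous_on (Domain (adjoint_op A)) (graph_norm (adjoint_op A)) (functional_norm V n) F \<and>
     (\<forall>f\<in>Domain T. F f = antidual_embed V (\<Gamma>0 f))"

end

theory Submission
  imports Defs
begin

text \<open>
  Everything is read off from one bounded operator. Put \<open>K h = \<Gamma>1 ((A0 + \<i>)\<^sup>-\<^sup>1 h)\<close>. Green's identity
  says that \<open>K\<close> is the adjoint of the \<open>\<gamma>\<close>-field at \<open>\<i>\<close> (lemma \<open>gamma_adj_eq\<close>), and \<open>K\<close> maps the Hilbert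
  space onto \<open>G1\<close>. By (ii) it is bounded into \<open>(G1, N)\<close>, hence by (i) into the boundary space, so that
  the \<open>\<gamma>\<close>-field extends to a bounded operator \<open>C\<close>. The resolvent identity carries (ii) from one point
  of the resolvent set to all others (\<open>gamma_adj_N_bound\<close>).

  Extension of \<open>\<Gamma>0\<close>. For \<open>f\<close> in the domain of \<open>T\<close> and \<open>u\<close> in the kernel of \<open>\<Gamma>0\<close>, Green's identity
  reads \<open>(\<Gamma>0 f, \<Gamma>1 u) = (f, T u) - (T f, u)\<close>. The right-hand side makes sense for every \<open>f\<close> in the
  domain of \<open>A\<^sup>*\<close>, with \<open>A\<^sup>* f\<close> in place of \<open>T f\<close>, and depends continuously on \<open>f\<close> in the graph norm;
  it defines the functional \<open>extension f\<close> on \<open>G1\<close>. As the graph of \<open>T\<close> is dense in that of \<open>A\<^sup>*\<close>,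
  the values at \<open>\<Gamma>1 u\<close> do not depend on the choice of \<open>u\<close>, and a continuous extension is unique. The
  estimate of \<open>extension f\<close> in the norm of the anti-dual is an instance of the uniform boundedness
  principle on \<open>(G1, N)\<close> (\<open>ext_bound\<close>). Surjectivity is Riesz' theorem: for \<open>\<phi>\<close> in the anti-dual,
  \<open>\<phi> \<circ> K\<close> is represented by a vector \<open>z\<close>, and since \<open>\<Gamma>0\<close> and \<open>\<Gamma>1\<close> vanish on the domain of \<open>A\<close>, this
  \<open>z\<close> satisfies \<open>A\<^sup>* z = \<i> z\<close> and is mapped to \<open>\<phi>\<close> (\<open>ext_surj\<close>).

  Equivalence of norms. Green's identity on the eigenspace at \<open>\<i>\<close> gives \<open>\<Lambda> = K C\<close>, where \<open>C\<close> is the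
  adjoint of \<open>K\<close> (\<open>Lambda_op_eq\<close>). Its root \<open>S\<close> satisfies \<open>norm (S x) = norm (C x)\<close>, so by Douglas' lemma
  \<open>S\<close> and \<open>K\<close> have the same range \<open>G1\<close>, and every \<open>S x\<close> is \<open>K h\<close> for some \<open>h\<close> with \<open>norm h \<le> norm x\<close>;
  boundedness of \<open>K\<close> into \<open>(G1, N)\<close> now bounds \<open>N\<close> by the norm of \<open>\<Lambda>\<^sup>-\<^sup>1\<^sup>/\<^sup>2\<close>. The reverse bound is again
  uniform boundedness, applied to the functionals \<open>y \<mapsto> (y, u)\<close> with \<open>norm (S u) \<le> 1\<close>.

  The tools are developed from the inner product: the Riesz theorem on a subspace, uniform boundedness
  for a norm given on a subspace, existence and uniqueness of square roots of bounded non-negative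
  operators, and the resolvent set of a self-adjoint operator.
\<close>

section \<open>Complex inner products\<close>

lemma cinner_add_right: "cinner x (y + z) = cinner x y + cinner x z"
  for x :: "'a::chilbert_space"
  by (metis cinner_add_left cinner_commute complex_cnj_add)

lemma cinner_scaleC_right: "cinner x (a *\<^sub>C y) = cnj a * cinner x y"
  for x :: "'a::chilbert_space"
  by (metis cinner_commute cinner_scaleC_left complex_cnj_mult)

lemma scaleC_minus_one: "(- 1) *\<^sub>C x = - x" for x :: "'a::complex_vector"
  by (simp add: scaleC_one)

lemma cinner_zero [simp]: "cinner 0 x = 0" "cinner x 0 = 0" for x :: "'a::chilbert_space"
  using cinner_add_left[of 0 0 x] cinner_add_right[of x 0 0] by simp_all

lemma cinner_minus: "cinner (- x) y = - cinner x y" "cinner x (- y) = - cinner x y"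
  for x :: "'a::chilbert_space"
  using cinner_add_left[of x "- x" y] cinner_add_right[of x y "- y"]
  by (simp_all add: add_eq_0_iff)

lemma cinner_diff_left: "cinner (x - y) z = cinner x z - cinner y z"
  for x :: "'a::chilbert_space"
  using cinner_add_left[of x "- y" z] by (simp add: cinner_minus)

lemma cinner_diff_right: "cinner x (y - z) = cinner x y - cinner x z"
  for x :: "'a::chilbert_space"
  using cinner_add_right[of x y "- z"] by (simp add: cinner_minus)

lemma cinner_scaleR:
  "cinner (r *\<^sub>R x) y = of_real r * cinner x y" "cinner x (r *\<^sub>R y) = of_real r * cinner x y"
  for x :: "'a::chilbert_space"
  by (simp_all add: scaleR_scaleC cinner_scaleC_left cinner_scaleC_right)

lemmas cinner_simps = cinner_add_left cinner_add_right cinner_diff_left cinner_diff_right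
  cinner_scaleC_left cinner_scaleC_right cinner_scaleR cinner_minus

lemma Re_cinner_self: "Re (cinner x x) = (norm x)\<^sup>2" "Im (cinner x x) = 0"
  for x :: "'a::chilbert_space"
  by (simp_all add: cinner_self_eq_norm)

lemma complex_mult_cnj_norm: "a * cnj a = (of_real (cmod a))\<^sup>2"
  using complex_norm_square[of a] by simp

lemma norm_scaleC: "norm (a *\<^sub>C x) = cmod a * norm x" for x :: "'a::chilbert_space"
proof -
  have "complex_of_real ((norm (a *\<^sub>C x))\<^sup>2) = of_real ((cmod a * norm x)\<^sup>2)"
    unfolding cinner_self_eq_norm[symmetric] cinner_simps power_mult_distrib
    by (simp add: cinner_self_eq_norm mult.commute[of "cnj a"] complex_mult_cnj_norm)
  then have "(norm (a *\<^sub>C x))\<^sup>2 = (cmod a * norm x)\<^sup>2"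
    using of_real_eq_iff by blast
  then show ?thesis by (simp add: power2_eq_iff_nonneg)
qed

lemma norm_diff_square:
  "(norm (x - y))\<^sup>2 = (norm x)\<^sup>2 - 2 * Re (cinner x y) + (norm y)\<^sup>2"
  for x :: "'a::chilbert_space"
proof -
  have "Re (cinner y x) = Re (cinner x y)" by (subst cinner_commute) simp
  then show ?thesis
    by (simp add: Re_cinner_self[symmetric] cinner_simps algebra_simps)
qed

lemma Cauchy_Schwarz_cinner: "cmod (cinner x y) \<le> norm x * norm y"
  for x :: "'a::chilbert_space"
proof (cases "y = 0")
  case False
  define d where "d = cinner x y"
  define a where "a = d / of_real ((norm y)\<^sup>2)"
  have y: "(norm y)\<^sup>2 > 0" using False by simp
  have "cinner x (a *\<^sub>C y) = of_real ((cmod d)\<^sup>2 / (norm y)\<^sup>2)"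
    using y by (simp add: a_def cinner_simps d_def[symmetric] mult.commute[of "cnj d"] complex_mult_cnj_norm)
  then have "0 \<le> (norm x)\<^sup>2 - 2 * ((cmod d)\<^sup>2 / (norm y)\<^sup>2) + (cmod a * norm y)\<^sup>2"
    using norm_diff_square[of x "a *\<^sub>C y"] zero_le_power2[of "norm (x - a *\<^sub>C y)"]
    by (simp add: norm_scaleC del: zero_le_power2)
  moreover have "(cmod a * norm y)\<^sup>2 = (cmod d)\<^sup>2 / (norm y)\<^sup>2"
  proof -
    have "cmod a = cmod d / (norm y)\<^sup>2" by (simp add: a_def norm_divide norm_power)
    then show ?thesis using y by (simp add: power2_eq_square field_simps)
  qed
  ultimately have "(cmod d)\<^sup>2 \<le> (norm x * norm y)\<^sup>2"
    using y by (simp add: field_simps power_mult_distrib)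
  then show ?thesis unfolding d_def by (rule power2_le_imp_le) simp
qed simp

lemma bounded_bilinear_cinner: "bounded_bilinear (cinner :: 'a::chilbert_space \<Rightarrow> _)"
  by standard (auto simp: cinner_simps scaleR_conv_of_real intro!: exI[of _ 1] Cauchy_Schwarz_cinner)

lemmas tendsto_cinner [tendsto_intros] = bounded_bilinear.tendsto[OF bounded_bilinear_cinner]

lemma cinner_eqI: "x = y" if "\<And>z. cinner x z = cinner y z" for x :: "'a::chilbert_space"
proof -
  have "cinner (x - y) (x - y) = 0" using that by (simp add: cinner_diff_left)
  then show ?thesis by (simp add: cinner_self_eq_norm)
qed

text \<open>A vector is determined by its inner products with a dense set, because the inner product is
  continuous.\<close>

lemma orthogonal_dense_imp_zero:
  fixes x :: "'a::chilbert_space"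
  assumes "closure D = UNIV" "\<And>d. d \<in> D \<Longrightarrow> cinner x d = 0"
  shows "x = 0"
proof -
  obtain d where d: "\<And>n. d n \<in> D" "d \<longlonglongrightarrow> x"
    using assms(1) closure_sequential[of x D] by auto
  have "(\<lambda>n. cinner x (d n)) \<longlonglongrightarrow> cinner x x" by (intro tendsto_intros d)
  then have "cinner x x = 0" using d(1) assms(2) by (simp add: LIMSEQ_const_iff)
  then show ?thesis by (simp add: cinner_self_eq_norm)
qed

text \<open>Testing against the vector itself turns a weak bound into a norm bound; a dense set of test
  vectors suffices.\<close>

lemma norm_le_dense:
  fixes x :: "'a::chilbert_space"
  assumes "0 \<le> c" "closure D = UNIV" "\<And>d. d \<in> D \<Longrightarrow> cmod (cinner x d) \<le> c * norm d"
  shows "norm x \<le> c"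
proof -
  obtain d where d: "\<And>n. d n \<in> D" "d \<longlonglongrightarrow> x"
    using assms(2) closure_sequential[of x D] by auto
  have "(\<lambda>n. cmod (cinner x (d n))) \<longlonglongrightarrow> cmod (cinner x x)"
    "(\<lambda>n. c * norm (d n)) \<longlonglongrightarrow> c * norm x" by (intro tendsto_intros d)+
  then have "cmod (cinner x x) \<le> c * norm x" using d(1) assms(3) by (blast intro: LIMSEQ_le)
  then have le: "norm x * norm x \<le> c * norm x"
    by (simp add: cinner_self_eq_norm norm_power power2_eq_square norm_mult)
  then show ?thesis using assms(1) by (cases "x = 0") auto
qed

section \<open>The Riesz representation theorem\<close>

lemma clinear_on_add: "clinear_on V f \<Longrightarrow> x \<in> V \<Longrightarrow> y \<in> V \<Longrightarrow> f (x + y) = f x + f y"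
  and clinear_on_scaleC: "clinear_on V f \<Longrightarrow> x \<in> V \<Longrightarrow> f (a *\<^sub>C x) = a *\<^sub>C f x"
  by (auto simp: clinear_on_def)

lemma csubspace_scaleR: "csubspace V \<Longrightarrow> x \<in> V \<Longrightarrow> r *\<^sub>R x \<in> V"
  for x :: "'a::chilbert_space"
  by (simp add: scaleR_scaleC complex_vector.subspace_scale)

lemma clinear_on_diff:
  "csubspace V \<Longrightarrow> clinear_on V f \<Longrightarrow> x \<in> V \<Longrightarrow> y \<in> V \<Longrightarrow> f (x - y) = f x - f y"
  using clinear_on_add[of V f "x - y" y] by (simp add: complex_vector.subspace_diff)

lemma parallelogram_law:
  "(norm (x - y))\<^sup>2 = 2 * (norm x)\<^sup>2 + 2 * (norm y)\<^sup>2 - 4 * (norm ((1/2) *\<^sub>R (x + y)))\<^sup>2"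
  for x :: "'a::chilbert_space"
proof -
  have "(norm (x + y))\<^sup>2 = (norm x)\<^sup>2 + 2 * Re (cinner x y) + (norm y)\<^sup>2"
    using norm_diff_square[of x "- y"] by (simp add: cinner_simps)
  moreover have "4 * (norm ((1/2) *\<^sub>R (x + y)))\<^sup>2 = (norm (x + y))\<^sup>2"
    by (simp add: power_mult_distrib power_divide)
  ultimately show ?thesis by (simp add: norm_diff_square)
qed

text \<open>The functional is represented by the minimiser of the quadratic functional
  \<open>J v = norm v ^ 2 - 2 * Re (f v)\<close>: by the parallelogram law, minimising sequences are Cauchy,
  and the first variation of \<open>J\<close> at the limit vanishes. The minimiser is sought in the closure
  of \<open>V\<close>, since the lemma is applied to ranges of operators that are not known to be closed.\<close>

theorem riesz_representation:
  fixes f :: "'a::chilbert_space \<Rightarrow> complex"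
  assumes V: "csubspace V" and f: "clinear_on V f"
    and bound: "\<And>v. v \<in> V \<Longrightarrow> cmod (f v) \<le> c * norm v" and c: "0 \<le> c"
  obtains z where "\<forall>v\<in>V. f v = cinner v z" "norm z \<le> c"
proof -
  define J where "J v = (norm v)\<^sup>2 - 2 * Re (f v)" for v
  have J_lower: "- (c\<^sup>2) \<le> J v" if "v \<in> V" for v
  proof -
    have "Re (f v) \<le> c * norm v" using complex_Re_le_cmod bound[OF that] order_trans by blast
    then have "(norm v - c)\<^sup>2 \<le> J v + c\<^sup>2" by (simp add: J_def power2_diff mult.commute)
    then show ?thesis by (smt (verit) zero_le_power2)
  qed
  define I where "I = Inf (J ` V)"
  have V0: "0 \<in> V" using V by (rule complex_vector.subspace_0)
  have bdd: "bdd_below (J ` V)" using J_lower by (intro bdd_belowI[of _ "- (c\<^sup>2)"]) auto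
  have I_le: "I \<le> J v" if "v \<in> V" for v unfolding I_def using bdd that by (simp add: cINF_lower)
  have "\<exists>v\<in>V. J v < I + 1 / Suc n" for n
    using cInf_lessD[of "J ` V" "I + 1 / Suc n"] V0 unfolding I_def by fastforce
  then obtain v where v: "\<And>n. v n \<in> V" "\<And>n. J (v n) < I + 1 / Suc n" by metis
  have f_half: "Re (f ((1/2) *\<^sub>R (x + y))) = (Re (f x) + Re (f y)) / 2" if "x \<in> V" "y \<in> V" for x y
  proof -
    have "f ((1/2) *\<^sub>R (x + y)) = complex_of_real (1/2) *\<^sub>C (f x + f y)"
      using clinear_on_scaleC[OF f complex_vector.subspace_add[OF V that]] clinear_on_add[OF f that]
      by (simp add: scaleR_scaleC)
    also have "\<dots> = (1/2) *\<^sub>R (f x + f y)" by (simp only: scaleR_scaleC)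
    finally show ?thesis by simp
  qed
  have close: "(norm (v m - v n))\<^sup>2 \<le> 2 / Suc m + 2 / Suc n" for m n
  proof -
    have "(1/2) *\<^sub>R (v m + v n) \<in> V"
      using V v(1) by (simp add: csubspace_scaleR complex_vector.subspace_add del: scaleR_add_right)
    from I_le[OF this] f_half[OF v(1) v(1), of m n] v(2)[of m] v(2)[of n]
    show ?thesis unfolding parallelogram_law J_def by argo
  qed
  have "Cauchy v"
  proof (rule CauchyI)
    fix e :: real assume "0 < e"
    then obtain M where M: "inverse (real (Suc M)) < e\<^sup>2 / 4"
      using reals_Archimedean[of "e\<^sup>2 / 4"] by auto
    show "\<exists>M. \<forall>m\<ge>M. \<forall>n\<ge>M. norm (v m - v n) < e"
    proof (intro exI allI impI)
      fix m n assume "M \<le> m" "M \<le> n"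
      then have "1 / Suc m \<le> inverse (real (Suc M))" "1 / Suc n \<le> inverse (real (Suc M))"
        by (simp_all add: inverse_eq_divide frac_le)
      then have "(norm (v m - v n))\<^sup>2 < e\<^sup>2" using close[of m n] M by simp
      then show "norm (v m - v n) < e" using \<open>0 < e\<close> by (simp add: power2_less_imp_less)
    qed
  qed
  then obtain z where z: "v \<longlonglongrightarrow> z" using Cauchy_convergent convergent_def by blast
  have rep: "f w = cinner w z" if w: "w \<in> V" for w
  proof (rule ccontr)
    assume neq: "f w \<noteq> cinner w z"
    define d where "d = cinner w z - f w"
    have variation: "0 \<le> s\<^sup>2 * (cmod d * norm w)\<^sup>2 - 2 * s * (cmod d)\<^sup>2" for s :: real
    proof -
      define t where "t = - (of_real s * cnj d)"
      have "I \<le> J (v n) + ((norm (t *\<^sub>C w))\<^sup>2 + 2 * Re (t * (cinner w (v n) - f w)))" for n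
      proof -
        have "I \<le> J (v n + t *\<^sub>C w)"
          by (intro I_le complex_vector.subspace_add complex_vector.subspace_scale V v w)
        moreover have "f (v n + t *\<^sub>C w) = f (v n) + t * f w"
          using V v(1)[of n] w f
          by (simp add: clinear_on_add clinear_on_scaleC complex_vector.subspace_scale scaleC_complex_def)
        moreover have "(norm (v n + t *\<^sub>C w))\<^sup>2
            = (norm (v n))\<^sup>2 + 2 * Re (t * cinner w (v n)) + (norm (t *\<^sub>C w))\<^sup>2"
          using norm_diff_square[of "t *\<^sub>C w" "- v n"] by (simp add: cinner_simps add.commute)
        ultimately show ?thesis by (simp add: J_def algebra_simps)
      qed
      then have "- (1 / Suc n) \<le> (norm (t *\<^sub>C w))\<^sup>2 + 2 * Re (t * (cinner w (v n) - f w))" for n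
        using v(2)[of n] by (smt (verit))
      moreover have "(\<lambda>n. - (1 / Suc n)) \<longlonglongrightarrow> - 0"
        using LIMSEQ_inverse_real_of_nat by (intro tendsto_minus) (simp add: inverse_eq_divide)
      moreover have "(\<lambda>n. (norm (t *\<^sub>C w))\<^sup>2 + 2 * Re (t * (cinner w (v n) - f w)))
          \<longlonglongrightarrow> (norm (t *\<^sub>C w))\<^sup>2 + 2 * Re (t * (cinner w z - f w))"
        by (intro tendsto_intros z)
      ultimately have "- 0 \<le> (norm (t *\<^sub>C w))\<^sup>2 + 2 * Re (t * (cinner w z - f w))"
        by (blast intro: LIMSEQ_le)
      moreover have "t * (cinner w z - f w) = - of_real (s * (cmod d)\<^sup>2)"
        by (simp add: t_def d_def[symmetric] mult.assoc mult.commute[of "cnj d"] complex_mult_cnj_norm)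
      moreover have "cmod t = \<bar>s\<bar> * cmod d" by (simp add: t_def norm_mult)
      ultimately show ?thesis by (simp add: norm_scaleC power_mult_distrib mult.assoc)
    qed
    (* In the direction t of steepest descent the linear term is -2 s |d|^2; the step s = 1 / W
       is short enough for it to dominate the quadratic term. *)
    define W where "W = (norm w)\<^sup>2 + 1"
    have W: "W > 0" by (simp add: W_def add_nonneg_pos)
    have "0 \<le> (1 / W)\<^sup>2 * ((cmod d)\<^sup>2 * W) - 2 * (1 / W) * (cmod d)\<^sup>2"
    proof -
      have "(cmod d * norm w)\<^sup>2 \<le> (cmod d)\<^sup>2 * W"
        by (simp add: W_def power_mult_distrib algebra_simps)
      then have "(1 / W)\<^sup>2 * (cmod d * norm w)\<^sup>2 \<le> (1 / W)\<^sup>2 * ((cmod d)\<^sup>2 * W)"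
        by (rule mult_left_mono) simp
      then show ?thesis using variation[of "1 / W"] by linarith
    qed
    also have "\<dots> = - ((cmod d)\<^sup>2 / W)" using W by (simp add: field_simps power2_eq_square)
    finally have "d = 0" using W by (simp add: divide_le_0_iff)
    then show False using neq by (simp add: d_def)
  qed
  have "norm z \<le> c"
  proof -
    have "(norm z)\<^sup>2 \<le> c * norm z"
    proof (rule LIMSEQ_le)
      show "(\<lambda>n. cmod (f (v n))) \<longlonglongrightarrow> (norm z)\<^sup>2"
      proof -
        have "(\<lambda>n. cmod (cinner (v n) z)) \<longlonglongrightarrow> cmod (cinner z z)" by (intro tendsto_intros z)
        then show ?thesis using rep v(1) by (simp add: cinner_self_eq_norm norm_power)
      qed
      show "(\<lambda>n. c * norm (v n)) \<longlonglongrightarrow> c * norm z" by (intro tendsto_intros z)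
    qed (use bound v(1) in blast)
    then show ?thesis using c by (cases "z = 0") (auto simp: power2_eq_square)
  qed
  with rep show thesis using that by blast
qed


section \<open>Norms on a subspace and uniform boundedness\<close>

lemma is_norm_on_norm: "is_norm_on V (norm :: 'a::chilbert_space \<Rightarrow> real)"
  by (simp add: is_norm_on_def norm_scaleC norm_triangle_ineq)

lemma is_norm_on_nonneg: "is_norm_on V n \<Longrightarrow> x \<in> V \<Longrightarrow> 0 \<le> n x"
  and is_norm_on_eq_0: "is_norm_on V n \<Longrightarrow> x \<in> V \<Longrightarrow> n x = 0 \<Longrightarrow> x = 0"
  and is_norm_on_scaleC: "is_norm_on V n \<Longrightarrow> x \<in> V \<Longrightarrow> n (a *\<^sub>C x) = cmod a * n x"
  and is_norm_on_triangle: "is_norm_on V n \<Longrightarrow> x \<in> V \<Longrightarrow> y \<in> V \<Longrightarrow> n (x + y) \<le> n x + n y"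
  by (auto simp: is_norm_on_def)

lemma is_norm_on_minus: "is_norm_on V n \<Longrightarrow> x \<in> V \<Longrightarrow> n (- x) = n x"
  using is_norm_on_scaleC[of V n x "- 1"] by (simp add: scaleC_minus_one)

lemma is_norm_on_diff_commute:
  "is_norm_on V n \<Longrightarrow> csubspace V \<Longrightarrow> x \<in> V \<Longrightarrow> y \<in> V \<Longrightarrow> n (x - y) = n (y - x)"
  by (metis complex_vector.subspace_diff is_norm_on_minus minus_diff_eq)

lemma is_norm_on_diff_triangle:
  assumes "is_norm_on V n" "csubspace V" "x \<in> V" "y \<in> V" "z \<in> V"
  shows "n (x - z) \<le> n (x - y) + n (y - z)"
  using is_norm_on_triangle[of V n "x - y" "y - z"] assms by (simp add: complex_vector.subspace_diff)

text \<open>The two directions of the equivalence of continuity and boundedness, assuming only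
  homogeneity over the reals, respectively compatibility with differences: this covers linear and
  antilinear maps at once.\<close>

lemma norm_continuous_on_imp_bounded:
  assumes V: "csubspace V" "is_norm_on V n" and W: "is_norm_on W m" "f ` V \<subseteq> W"
    and hom: "\<And>r x. x \<in> V \<Longrightarrow> f (complex_of_real r *\<^sub>C x) = complex_of_real r *\<^sub>C f x"
    and cont: "norm_continuous_on V n m f"
  obtains c where "0 < c" "\<And>x. x \<in> V \<Longrightarrow> m (f x) \<le> c * n x"
proof -
  have V0: "0 \<in> V" using V(1) by (rule complex_vector.subspace_0)
  have f0: "f 0 = 0" using hom[OF V0, of 0] by simp
  obtain d where d: "d > 0" "\<And>y. y \<in> V \<Longrightarrow> n y < d \<Longrightarrow> m (f y) < 1"
    using cont V0 f0 unfolding norm_continuous_on_def by (metis diff_zero zero_less_one)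
  have "m (f x) \<le> (2 / d) * n x" if x: "x \<in> V" for x
  proof (cases "n x = 0")
    case True
    then have "x = 0" using V(2) x is_norm_on_eq_0 by blast
    moreover have "m 0 = 0" using is_norm_on_scaleC[OF W(1), of "f 0" 0] W(2) V0 f0 by force
    ultimately show ?thesis using f0 True by simp
  next
    case False
    then have nx: "n x > 0" using is_norm_on_nonneg[OF V(2) x] by simp
    define r where "r = d / (2 * n x)"
    have r: "r > 0" using d(1) nx by (simp add: r_def)
    have "n (complex_of_real r *\<^sub>C x) < d"
      unfolding is_norm_on_scaleC[OF V(2) x] using r d(1) nx by (simp add: r_def norm_divide norm_mult)
    then have "m (f (complex_of_real r *\<^sub>C x)) < 1"
      using d(2) complex_vector.subspace_scale[OF V(1) x] by blast
    then have "r * m (f x) < 1"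
      using hom[OF x, of r] is_norm_on_scaleC[OF W(1), of "f x" "of_real r"] W(2) x r by auto
    then show ?thesis using d(1) nx by (simp add: r_def field_simps)
  qed
  then show thesis using that[of "2 / d"] d(1) by simp
qed

lemma norm_continuous_on_if_bounded:
  assumes "csubspace V"
    and diff: "\<And>x y. x \<in> V \<Longrightarrow> y \<in> V \<Longrightarrow> f (x - y) = f x - f y"
    and bound: "\<And>x. x \<in> V \<Longrightarrow> m (f x) \<le> c * n x" and c: "0 \<le> c"
  shows "norm_continuous_on V n m f"
  unfolding norm_continuous_on_def
proof (intro ballI allI impI)
  fix x and e :: real assume x: "x \<in> V" and e: "0 < e"
  have "m (f y - f x) < e" if "y \<in> V" "n (y - x) < e / (c + 1)" for y
  proof -
    have nonneg: "m (f y - f x) \<le> c * n (y - x)"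
      using diff[OF that(1) x] bound[of "y - x"] assms(1) that(1) x
      by (simp add: complex_vector.subspace_diff)
    also have "\<dots> \<le> c * (e / (c + 1))" using that(2) c by (intro mult_left_mono) auto
    also have "\<dots> < e" using c e by (simp add: field_simps)
    finally show ?thesis .
  qed
  then show "\<exists>d>0. \<forall>y\<in>V. n (y - x) < d \<longrightarrow> m (f y - f x) < e"
    using c e by (intro exI[of _ "e / (c + 1)"]) auto
qed

text \<open>Uniform boundedness for seminorms, by the nested ball argument: if no uniform bound existed,
  every ball would contain a smaller one on which some member of the family exceeds a prescribed
  number. Indeed \<open>p\<close> is at least \<open>p z\<close> at one of the points \<open>x + z\<close> and \<open>x - z\<close>, whose difference is
  \<open>2 z\<close>; so a seminorm is at least as large near \<open>x\<close> as near zero.\<close>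

theorem uniform_boundedness:
  fixes n :: "'a::complex_vector \<Rightarrow> real" and P :: "('a \<Rightarrow> real) set"
  assumes V: "csubspace V" "is_norm_on V n" "complete_norm_on V n"
    and triangle: "\<And>p x y. p \<in> P \<Longrightarrow> x \<in> V \<Longrightarrow> y \<in> V \<Longrightarrow> p (x + y) \<le> p x + p y"
    and hom: "\<And>p a x. p \<in> P \<Longrightarrow> x \<in> V \<Longrightarrow> p (a *\<^sub>C x) = cmod a * p x"
    and bounded: "\<And>p. p \<in> P \<Longrightarrow> \<exists>c. \<forall>x\<in>V. p x \<le> c * n x"
    and pointwise: "\<And>x. x \<in> V \<Longrightarrow> \<exists>c. \<forall>p\<in>P. p x \<le> c"
  obtains C where "0 < C" "\<And>p x. p \<in> P \<Longrightarrow> x \<in> V \<Longrightarrow> p x \<le> C * n x"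
proof -
  note sub = complex_vector.subspace_add[OF V(1)] complex_vector.subspace_diff[OF V(1)]
    complex_vector.subspace_scale[OF V(1)] complex_vector.subspace_neg[OF V(1)]
  note n = is_norm_on_nonneg[OF V(2)] is_norm_on_scaleC[OF V(2)]
  have p_minus: "p (- x) = p x" if "p \<in> P" "x \<in> V" for p x
    using hom[OF that, of "- 1"] by (simp add: scaleC_minus_one)
  have "\<exists>C>0. \<forall>p\<in>P. \<forall>x\<in>V. p x \<le> C * n x"
  proof (rule ccontr)
    assume unbounded: "\<not> (\<exists>C>0. \<forall>p\<in>P. \<forall>x\<in>V. p x \<le> C * n x)"
    have far: "\<exists>y\<in>V. \<exists>p\<in>P. n (y - x) \<le> r \<and> M < p y" if x: "x \<in> V" and r: "r > 0" and M: "M > 0"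
      for x r M
    proof -
      (* Rescaled to norm r, a vector violating the bound with constant M / r has p-value above M. *)
      obtain p z where p: "p \<in> P" and z: "z \<in> V" and pz: "p z > (M / r) * n z"
        using unbounded r M by (metis divide_pos_pos not_le)
      have "n z \<noteq> 0"
      proof
        assume "n z = 0"
        moreover obtain c where "\<forall>x\<in>V. p x \<le> c * n x" using bounded p by blast
        ultimately show False using pz z by fastforce
      qed
      then have nz: "n z > 0" using n(1)[OF z] by simp
      define w where "w = complex_of_real (r / n z) *\<^sub>C z"
      have w: "w \<in> V" "n w = r" "p w > M"
      proof -
        show "w \<in> V" by (simp add: w_def sub z)
        show "n w = r" using nz r by (simp only: w_def n(2)[OF z]) (simp add: norm_divide)
        have "p w = (r / n z) * p z"
          using nz r by (simp only: w_def hom[OF p z]) (simp add: norm_divide)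
        moreover have "M < (r / n z) * p z" using pz r nz by (simp add: field_simps)
        ultimately show "p w > M" by simp
      qed
      have "2 * p w \<le> p (x + w) + p (x - w)"
      proof -
        have "2 * p w = p (2 *\<^sub>C w)" by (simp add: hom p w)
        also have "2 *\<^sub>C w = (x + w) + - (x - w)"
          using scaleC_add_left[of 1 1 w] by (simp add: scaleC_one)
        also have "p \<dots> \<le> p (x + w) + p (x - w)"
          using triangle[OF p, of "x + w" "- (x - w)"] p_minus[OF p, of "x - w"] sub x w by metis
        finally show ?thesis .
      qed
      then consider "M < p (x + w)" | "M < p (x - w)" using w(3) by linarith
      then show ?thesis
      proof cases
        case 1 then show ?thesis using p w x sub by (intro bexI[of _ "x + w"] bexI[of _ p]) auto
      next
        case 2 then show ?thesis using p w x sub is_norm_on_minus[OF V(2) w(1)]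
          by (intro bexI[of _ "x - w"] bexI[of _ p]) auto
      qed
    qed
    let ?ball = "\<lambda>x r. {w\<in>V. n (w - x) \<le> r}"
    let ?ok = "\<lambda>q :: 'a \<times> real. fst q \<in> V \<and> 0 < snd q"
    let ?step = "\<lambda>k q q'. n (fst q' - fst q) \<le> snd q / 2 \<and> snd q' \<le> snd q / 2
      \<and> (\<exists>p\<in>P. \<forall>w \<in> ?ball (fst q') (snd q'). real k \<le> p w)"
    have refine: "\<exists>q'. ?ok q' \<and> ?step k q q'" if q: "?ok q" for q k
    proof -
      obtain y p where y: "y \<in> V" "n (y - fst q) \<le> snd q / 2" and p: "p \<in> P" "real k + 1 < p y"
        using far[of "fst q" "snd q / 2" "real k + 1"] q by auto
      obtain c where c: "\<forall>x\<in>V. p x \<le> c * n x" using bounded p(1) by blast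
      (* On the ball of radius s about y the seminorm p drops by at most 1 below p y. *)
      define s where "s = min (snd q / 2) (1 / (\<bar>c\<bar> + 1))"
      have "real k \<le> p w" if w: "w \<in> ?ball y s" for w
      proof -
        have "p y \<le> p w + p (w - y)"
          using triangle[OF p(1), of w "- (w - y)"] p_minus[OF p(1), of "w - y"] sub w y by auto
        moreover have "p (w - y) \<le> 1"
        proof -
          have "p (w - y) \<le> c * n (w - y)" using c w y sub by blast
          also have "\<dots> \<le> (\<bar>c\<bar> + 1) * n (w - y)"
            using n(1)[of "w - y"] w y sub by (intro mult_right_mono) auto
          also have "\<dots> \<le> (\<bar>c\<bar> + 1) * (1 / (\<bar>c\<bar> + 1))"
            using w by (intro mult_left_mono) (auto simp: s_def)
          also have "\<dots> = 1" by simp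
          finally show ?thesis .
        qed
        ultimately show ?thesis using p(2) by linarith
      qed
      moreover have "s > 0" "s \<le> snd q / 2" using q by (auto simp: s_def)
      ultimately show ?thesis using y p(1) by (intro exI[of _ "(y, s)"]) auto
    qed
    have start: "\<exists>q. ?ok q"
      by (intro exI[of _ "(0, 1)"]) (simp add: complex_vector.subspace_0[OF V(1)])
    have "\<exists>q. \<forall>k. ?ok (q k) \<and> ?step k (q k) (q (Suc k))"
      by (rule dependent_nat_choice[of "\<lambda>_. ?ok" ?step, OF start refine])
    then obtain q where q: "\<And>k. ?ok (q k)" "\<And>k. ?step k (q k) (q (Suc k))" by blast
    define X where "X k = fst (q k)" for k
    define r where "r k = snd (q k)" for k
    have X: "X k \<in> V" and r: "0 < r k" for k using q(1) by (auto simp: X_def r_def)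
    have near: "n (X (Suc k) - X k) \<le> r k / 2" and half: "r (Suc k) \<le> r k / 2"
      and large: "\<exists>p\<in>P. \<forall>w \<in> ?ball (X (Suc k)) (r (Suc k)). real k \<le> p w" for k
      using q(2)[of k] by (auto simp: X_def r_def)
    have tail: "n (X j - X k) \<le> r k - r j" if "k \<le> j" for j k
      using that
    proof (induction j rule: dec_induct)
      case base
      then show ?case using n(2)[OF X[of k], of 0] n(2)[OF complex_vector.subspace_0[OF V(1)], of 0] by simp
    next
      case (step j)
      have "n (X (Suc j) - X k) \<le> n (X (Suc j) - X j) + n (X j - X k)"
        by (rule is_norm_on_diff_triangle[OF V(2,1) X X X])
      then show ?case using step(3) near[of j] half[of j] by linarith
    qed
    have r_small: "r k \<le> r 0 * (1/2) ^ k" for k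
    proof (induction k)
      case (Suc k) then show ?case using half[of k] by simp
    qed simp
    have "(\<lambda>k. r 0 * (1/2) ^ k) \<longlonglongrightarrow> 0" by (intro tendsto_mult_right_zero LIMSEQ_power_zero) simp
    have Cauchy: "\<exists>K. \<forall>i\<ge>K. \<forall>j\<ge>K. n (X i - X j) < e" if e: "e > 0" for e
    proof -
      obtain K where "r 0 * (1/2) ^ K < e / 2"
        using \<open>(\<lambda>k. r 0 * (1/2) ^ k) \<longlonglongrightarrow> 0\<close> e unfolding LIMSEQ_def dist_real_def
        by (metis abs_less_iff diff_zero half_gt_zero le_refl)
      then have rK: "r K < e / 2" using r_small[of K] by linarith
      have "n (X i - X j) < e" if "i \<ge> K" "j \<ge> K" for i j
      proof -
        have "n (X i - X j) \<le> n (X i - X K) + n (X K - X j)"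
          by (rule is_norm_on_diff_triangle[OF V(2,1) X X X])
        moreover have "n (X K - X j) = n (X j - X K)" by (rule is_norm_on_diff_commute[OF V(2,1) X X])
        ultimately show ?thesis using tail[OF that(1)] tail[OF that(2)] r[of i] r[of j] rK by linarith
      qed
      then show ?thesis by blast
    qed
    then obtain x where x: "x \<in> V" "(\<lambda>k. n (X k - x)) \<longlonglongrightarrow> 0"
      using V(3) X unfolding complete_norm_on_def by blast
    have in_ball: "n (x - X k) \<le> r k" for k
    proof (rule LIMSEQ_le_const)
      show "(\<lambda>j. n (X j - x) + r k) \<longlonglongrightarrow> r k" using tendsto_add[OF x(2) tendsto_const[of "r k"]] by simp
      have "n (x - X k) \<le> n (X j - x) + r k" if "k \<le> j" for j
        using is_norm_on_diff_triangle[OF V(2,1) x(1) X X, of k j] tail[OF that] r[of j]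
          is_norm_on_diff_commute[OF V(2,1) x(1) X[of j]] by linarith
      then show "\<exists>N. \<forall>j\<ge>N. n (x - X k) \<le> n (X j - x) + r k" by blast
    qed
    obtain c where c: "\<forall>p\<in>P. p x \<le> c" using pointwise x(1) by blast
    obtain k where "real k > c" using reals_Archimedean2 by blast
    moreover obtain p where "p \<in> P" "real k \<le> p x" using large[of k] in_ball[of "Suc k"] x(1) by blast
    ultimately show False using c by fastforce
  qed
  then show thesis using that by blast
qed

section \<open>Square roots of bounded non-negative operators\<close>

definition positive_map :: "('a::chilbert_space \<Rightarrow> 'a) \<Rightarrow> bool" where
  "positive_map L \<longleftrightarrow> bounded_linear L \<and> (\<forall>x y. cinner (L x) y = cinner x (L y))
     \<and> (\<forall>x. 0 \<le> Re (cinner (L x) x))"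

lemma positive_map_linear: "positive_map L \<Longrightarrow> bounded_linear L"
  and positive_map_sym: "positive_map L \<Longrightarrow> cinner (L x) y = cinner x (L y)"
  and positive_map_nonneg: "positive_map L \<Longrightarrow> 0 \<le> Re (cinner (L x) x)"
  by (auto simp: positive_map_def)

text \<open>Positivity of the form \<open>(L y, y)\<close> at \<open>y = x - L x / c\<close>. This is a Cauchy--Schwarz
  inequality for the form; it yields both that \<open>L x\<close> vanishes with \<open>(L x, x)\<close> and that
  \<open>1 - L / c\<close> is a contraction.\<close>

lemma positive_map_norm_square_le:
  assumes L: "positive_map L" and c: "0 < c" and bound: "\<And>x. norm (L x) \<le> c * norm x"
  shows "(norm (L x))\<^sup>2 \<le> c * Re (cinner (L x) x)"
proof -
  interpret bounded_linear L using L by (rule positive_map_linear)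
  define t where "t = 1 / c"
  have t: "t > 0" "t * c = 1" using c by (simp_all add: t_def)
  have "Re (cinner (L (L x)) (L x)) \<le> c * (norm (L x))\<^sup>2"
  proof -
    have "Re (cinner (L (L x)) (L x)) \<le> norm (L (L x)) * norm (L x)"
      using complex_Re_le_cmod Cauchy_Schwarz_cinner order_trans by blast
    also have "\<dots> \<le> (c * norm (L x)) * norm (L x)" by (intro mult_right_mono bound) simp
    finally show ?thesis by (simp add: power2_eq_square)
  qed
  then have "t\<^sup>2 * Re (cinner (L (L x)) (L x)) \<le> t\<^sup>2 * (c * (norm (L x))\<^sup>2)"
    by (rule mult_left_mono) simp
  also have "\<dots> = t * (norm (L x))\<^sup>2" using t(2) by (simp add: power2_eq_square)
  finally have quad: "t\<^sup>2 * Re (cinner (L (L x)) (L x)) \<le> t * (norm (L x))\<^sup>2" .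
  have "0 \<le> Re (cinner (L (x - t *\<^sub>R L x)) (x - t *\<^sub>R L x))" by (rule positive_map_nonneg[OF L])
  also have "\<dots> = Re (cinner (L x) x) - 2 * t * (norm (L x))\<^sup>2 + t\<^sup>2 * Re (cinner (L (L x)) (L x))"
    by (simp add: diff scaleR cinner_simps positive_map_sym[OF L, of "L x" x] Re_cinner_self
        power2_eq_square algebra_simps)
  finally have "t * (norm (L x))\<^sup>2 \<le> Re (cinner (L x) x)" using quad by linarith
  then have "c * (t * (norm (L x))\<^sup>2) \<le> c * Re (cinner (L x) x)"
    using c by (intro mult_left_mono) auto
  then show ?thesis using t(2) by (simp add: mult.assoc[symmetric] mult.commute)
qed

lemma positive_map_bound:
  assumes "positive_map L"
  obtains c where "0 < c" "\<And>x. norm (L x) \<le> c * norm x"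
  using bounded_linear.pos_bounded[OF positive_map_linear[OF assms]] by (auto simp: mult.commute)

lemma positive_map_eq_0:
  assumes "positive_map L" "Re (cinner (L x) x) = 0"
  shows "L x = 0"
proof -
  obtain c where "0 < c" "\<And>x. norm (L x) \<le> c * norm x" using positive_map_bound[OF assms(1)] by blast
  from positive_map_norm_square_le[OF assms(1) this, of x] show ?thesis using assms(2) by simp
qed

text \<open>Scaling reduces to \<open>L = c (1 - A)\<close> with \<open>A\<close> a symmetric contraction, and \<open>1 - B\<close> is a
  square root of \<open>1 - A\<close> if \<open>B\<close> solves \<open>B = (A + B\<^sup>2) / 2\<close>. The iteration for this
  equation, started at zero, is dominated by the same iteration for the number \<open>1\<close>, which is
  increasing and bounded by \<open>1\<close>; hence it converges in operator norm. All iterates are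
  polynomials in \<open>A\<close>, so that the root commutes with everything that commutes with \<open>L\<close>; this is
  what uniqueness rests on.\<close>

theorem positive_map_sqrt_exists:
  assumes L: "positive_map L"
  obtains S where "positive_map S" "\<And>x. S (S x) = L x"
    "\<forall>R. bounded_linear R \<longrightarrow> (\<forall>x. R (L x) = L (R x)) \<longrightarrow> (\<forall>x. R (S x) = S (R x))"
proof -
  interpret L: bounded_linear L using L by (rule positive_map_linear)
  obtain c where c: "0 < c" "\<And>x. norm (L x) \<le> c * norm x" using positive_map_bound[OF L] by blast
  define A where "A = Blinfun (\<lambda>x. x - (1 / c) *\<^sub>R L x)"
  have A: "A x = x - (1 / c) *\<^sub>R L x" for x
    unfolding A_def
    by (subst bounded_linear_Blinfun_apply)
      (auto intro!: bounded_linear_sub bounded_linear_ident bounded_linear_scaleR_right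
        bounded_linear_compose[OF bounded_linear_scaleR_right L.bounded_linear_axioms])
  have A_sym: "cinner (A x) y = cinner x (A y)" for x y
    by (simp add: A cinner_simps positive_map_sym[OF L])
  have "norm (A x) \<le> 1 * norm x" for x
  proof -
    have "Re (cinner x (L x)) = Re (cinner (L x) x)" by (simp add: positive_map_sym[OF L])
    then have "(norm (A x))\<^sup>2 = (norm x)\<^sup>2 - (2 / c) * Re (cinner (L x) x) + (1 / c)\<^sup>2 * (norm (L x))\<^sup>2"
      by (simp add: A norm_diff_square cinner_simps power_mult_distrib power_divide)
    moreover have "(1 / c)\<^sup>2 * (norm (L x))\<^sup>2 \<le> (1 / c)\<^sup>2 * (c * Re (cinner (L x) x))"
      by (intro mult_left_mono positive_map_norm_square_le[OF L c]) simp
    moreover have "(1 / c)\<^sup>2 * (c * Re (cinner (L x) x)) = (1 / c) * Re (cinner (L x) x)"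
      using c(1) by (simp add: power2_eq_square)
    moreover have "0 \<le> (1 / c) * Re (cinner (L x) x)"
      using c(1) positive_map_nonneg[OF L] by simp
    ultimately have "(norm (A x))\<^sup>2 \<le> (norm x)\<^sup>2" by linarith
    from power2_le_imp_le[OF this] show ?thesis by simp
  qed
  then have A_norm: "norm A \<le> 1" by (intro norm_blinfun_bound) auto
  define Y where "Y = rec_nat 0 (\<lambda>_ Z. (1/2) *\<^sub>R (A + (Z o\<^sub>L Z)))"
  define y where "y = rec_nat 0 (\<lambda>_ s. (1 + s\<^sup>2) / 2 :: real)"
  have Y: "Y 0 = 0" "\<And>n. Y (Suc n) = (1/2) *\<^sub>R (A + (Y n o\<^sub>L Y n))" by (simp_all add: Y_def)
  have y: "y 0 = 0" "\<And>n. y (Suc n) = (1 + (y n)\<^sup>2) / 2" by (simp_all add: y_def)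
  have y_bounds: "0 \<le> y n \<and> y n \<le> 1" for n
  proof (induction n)
    case (Suc n)
    then show ?case using power_le_one[of "y n" 2] by (simp add: y)
  qed (simp add: y)
  have Y_le: "norm (Y n) \<le> y n" for n
  proof (induction n)
    case (Suc n)
    have "norm (A + (Y n o\<^sub>L Y n)) \<le> norm A + norm (Y n) * norm (Y n)"
      using norm_triangle_ineq[of A "Y n o\<^sub>L Y n"] norm_blinfun_compose[of "Y n" "Y n"] by linarith
    also have "\<dots> \<le> 1 + y n * y n" using A_norm Suc y_bounds by (intro add_mono mult_mono) auto
    finally show ?case by (simp add: Y y power2_eq_square)
  qed (simp add: Y y)
  have increment: "norm (Y (Suc n) - Y n) \<le> y (Suc n) - y n" for n
  proof (induction n)
    case 0 then show ?case using A_norm by (simp add: Y y)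
  next
    case (Suc n)
    let ?D = "Y (Suc n) - Y n" and ?d = "y (Suc n) - y n"
    have "Y (Suc (Suc n)) - Y (Suc n) = (1/2) *\<^sub>R ((Y (Suc n) o\<^sub>L ?D) + (?D o\<^sub>L Y n))"
    proof -
      have "Y (Suc (Suc n)) - Y (Suc n)
          = (1/2) *\<^sub>R ((Y (Suc n) o\<^sub>L Y (Suc n)) - (Y n o\<^sub>L Y n))"
        by (subst Y(2)[of "Suc n"], subst (3) Y(2)) (simp add: scaleR_diff_right[symmetric])
      also have "(Y (Suc n) o\<^sub>L Y (Suc n)) - (Y n o\<^sub>L Y n) = (Y (Suc n) o\<^sub>L ?D) + (?D o\<^sub>L Y n)"
        by (rule blinfun_eqI) (simp add: blinfun.bilinear_simps)
      finally show ?thesis .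
    qed
    then have "norm (Y (Suc (Suc n)) - Y (Suc n))
        = (1/2) * norm ((Y (Suc n) o\<^sub>L ?D) + (?D o\<^sub>L Y n))" by simp
    also have "norm ((Y (Suc n) o\<^sub>L ?D) + (?D o\<^sub>L Y n)) \<le> norm (Y (Suc n)) * norm ?D + norm ?D * norm (Y n)"
      by (rule order_trans[OF norm_triangle_ineq add_mono[OF norm_blinfun_compose norm_blinfun_compose]])
    also have "\<dots> \<le> y (Suc n) * ?d + ?d * y n"
      using Suc Y_le[of n] Y_le[of "Suc n"] y_bounds[of n] y_bounds[of "Suc n"]
        order_trans[OF norm_ge_zero Suc]
      by (intro add_mono mult_mono) simp_all
    also have "(1/2) * (y (Suc n) * ?d + ?d * y n) = y (Suc (Suc n)) - y (Suc n)"
      by (simp add: y(2)[of "Suc n"] y(2)[of n] power2_eq_square field_simps)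
    finally show ?case by simp
  qed
  have "incseq y"
    using order_trans[OF norm_ge_zero increment] by (intro incseq_SucI) simp
  then obtain s where "y \<longlonglongrightarrow> s" using incseq_convergent[of y 1] y_bounds by blast
  then have y_Cauchy: "Cauchy y" by (rule LIMSEQ_imp_Cauchy)
  have Y_diff: "norm (Y m - Y n) \<le> y m - y n" if "n \<le> m" for m n
    using that
  proof (induction m rule: dec_induct)
    case (step m)
    have "norm (Y (Suc m) - Y n) \<le> norm (Y (Suc m) - Y m) + norm (Y m - Y n)"
      using norm_triangle_ineq[of "Y (Suc m) - Y m" "Y m - Y n"] by simp
    then show ?case using step(3) increment[of m] by linarith
  qed simp
  have "Cauchy Y"
  proof (rule CauchyI')
    fix e :: real assume "0 < e"
    then obtain M where M: "\<forall>m\<ge>M. \<forall>n\<ge>M. norm (y m - y n) < e" using CauchyD[OF y_Cauchy] by blast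
    have "norm (Y m - Y n) < e" if "M \<le> m" "m < n" for m n
    proof -
      have "norm (Y m - Y n) = norm (Y n - Y m)" by (rule norm_minus_commute)
      also have "\<dots> \<le> y n - y m" using that by (intro Y_diff) simp
      also have "\<dots> < e" using M[rule_format, of n m] that by simp
      finally show ?thesis .
    qed
    then show "\<exists>M. \<forall>m\<ge>M. \<forall>n>m. dist (Y m) (Y n) < e" unfolding dist_norm by blast
  qed
  then obtain B where B: "Y \<longlonglongrightarrow> B" using Cauchy_convergent convergent_def by blast
  have Bx: "(\<lambda>n. Y n x) \<longlonglongrightarrow> B x" for x by (intro tendsto_intros B)
  have B_norm: "norm B \<le> 1"
    using tendsto_norm[OF B] Y_le y_bounds by (intro LIMSEQ_le_const2) (auto intro: order_trans)
  have "(\<lambda>n. Y (Suc n)) \<longlonglongrightarrow> (1/2) *\<^sub>R (A + (B o\<^sub>L B))"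
    unfolding Y(2) by (intro tendsto_intros bounded_bilinear.tendsto[OF bounded_bilinear_blinfun_compose] B)
  then have "B = (1/2) *\<^sub>R (A + (B o\<^sub>L B))" using LIMSEQ_Suc[OF B] LIMSEQ_unique by blast
  then have B_eq: "B (B x) = 2 *\<^sub>R B x - A x" for x
  proof -
    have "B x = ((1/2) *\<^sub>R (A + (B o\<^sub>L B))) x" using \<open>B = _\<close> by simp
    then have "B x = (1/2) *\<^sub>R (A x + B (B x))" by (simp add: blinfun.bilinear_simps)
    from arg_cong[OF this, of "scaleR 2"] have "2 *\<^sub>R B x = A x + B (B x)" by simp
    then show ?thesis by simp
  qed
  have Y_sym: "cinner (Y n x) z = cinner x (Y n z)" for n x z
    by (induction n arbitrary: x z) (simp_all add: Y blinfun.bilinear_simps cinner_simps A_sym)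
  have B_sym: "cinner (B x) z = cinner x (B z)" for x z
  proof (rule LIMSEQ_unique)
    show "(\<lambda>n. cinner (Y n x) z) \<longlonglongrightarrow> cinner (B x) z" by (intro tendsto_intros Bx)
    show "(\<lambda>n. cinner (Y n x) z) \<longlonglongrightarrow> cinner x (B z)" unfolding Y_sym by (intro tendsto_intros Bx)
  qed
  define S where "S x = sqrt c *\<^sub>R (x - B x)" for x
  have S_lin: "bounded_linear S"
    unfolding S_def
    by (intro bounded_linear_compose[OF bounded_linear_scaleR_right] bounded_linear_sub
        bounded_linear_ident blinfun.bounded_linear_right)
  have "positive_map S"
    unfolding positive_map_def
  proof (intro conjI allI S_lin)
    fix x z
    show "cinner (S x) z = cinner x (S z)" by (simp add: S_def cinner_simps B_sym)
    have "Re (cinner (B x) x) \<le> norm (B x) * norm x"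
      using complex_Re_le_cmod Cauchy_Schwarz_cinner order_trans by blast
    also have "\<dots> \<le> (norm B * norm x) * norm x" by (intro mult_right_mono norm_blinfun) simp
    also have "\<dots> \<le> (1 * norm x) * norm x" by (intro mult_right_mono B_norm) auto
    finally show "0 \<le> Re (cinner (S x) x)"
      using c(1) by (simp add: S_def cinner_simps Re_cinner_self power2_eq_square)
  qed
  moreover have "S (S x) = L x" for x
  proof -
    have "S (S x) = sqrt c *\<^sub>R (sqrt c *\<^sub>R (x - B x) - sqrt c *\<^sub>R (B x - B (B x)))"
      by (simp add: S_def blinfun.bilinear_simps)
    also have "\<dots> = c *\<^sub>R ((x - B x) - (B x - B (B x)))"
      using c(1) by (simp flip: scaleR_diff_right)
    also have "\<dots> = c *\<^sub>R (x - A x)" by (simp add: B_eq scaleR_2)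
    also have "\<dots> = L x" using c(1) by (simp add: A)
    finally show ?thesis .
  qed
  moreover have "R (S x) = S (R x)" if R: "bounded_linear R" and comm: "\<And>x. R (L x) = L (R x)" for R x
  proof -
    interpret R: bounded_linear R by (rule R)
    have "R (Y n x) = Y n (R x)" for n x
      by (induction n arbitrary: x)
        (simp_all add: Y blinfun.bilinear_simps R.zero R.add R.scaleR A R.diff comm)
    then have "(\<lambda>n. Y n (R x)) \<longlonglongrightarrow> R (B x)" using R.tendsto[OF Bx[of x]] by simp
    then have "R (B x) = B (R x)" using Bx LIMSEQ_unique by blast
    then show ?thesis by (simp add: S_def R.scaleR R.diff)
  qed
  ultimately show thesis using that by blast
qed

text \<open>Let \<open>Q\<close> be the root of \<open>L\<close> given by \<open>positive_map_sqrt_exists\<close>, \<open>R\<close> any other one, and \<open>y = Q x - R x\<close>. Since \<open>R\<close>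
  commutes with \<open>L = R\<^sup>2\<close>, it commutes with \<open>Q\<close>, so that \<open>Q y + R y = Q\<^sup>2 x - R\<^sup>2 x = 0\<close>. By
  positivity \<open>Q y\<close> and \<open>R y\<close> both vanish, and then \<open>(y, y) = (x, Q y - R y) = 0\<close>.\<close>

lemma positive_map_sqrt_unique:
  assumes S: "positive_map S" and R: "positive_map R" and eq: "\<And>x. S (S x) = R (R x)"
  shows "S = R"
proof -
  define L where "L x = S (S x)" for x
  have "positive_map L"
    unfolding positive_map_def L_def
    by (auto simp: positive_map_sym[OF S, of "S _"] positive_map_sym[OF S, of _ "S _", symmetric]
        Re_cinner_self intro!: bounded_linear_compose[OF positive_map_linear[OF S] positive_map_linear[OF S]])
  then obtain Q where Q: "positive_map Q" "\<And>x. Q (Q x) = L x"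
    and comm: "\<forall>R. bounded_linear R \<longrightarrow> (\<forall>x. R (L x) = L (R x)) \<longrightarrow> (\<forall>x. R (Q x) = Q (R x))"
    by (rule positive_map_sqrt_exists) (rule that)
  have root: "R x = Q x" if R: "positive_map R" and RL: "\<And>x. R (R x) = L x" for R x
  proof -
    interpret Q: bounded_linear Q using Q(1) by (rule positive_map_linear)
    interpret R: bounded_linear R using R by (rule positive_map_linear)
    have RQ: "R (Q x) = Q (R x)" for x
      using comm R.bounded_linear_axioms by (simp flip: RL)
    define y where "y = Q x - R x"
    have "Q y + R y = 0" by (simp add: y_def Q.diff R.diff RQ RL Q)
    then have "Re (cinner (Q y + R y) y) = 0" by simp
    then have "Re (cinner (Q y) y) + Re (cinner (R y) y) = 0" by (simp add: cinner_simps)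
    then have "Re (cinner (Q y) y) = 0" "Re (cinner (R y) y) = 0"
      using positive_map_nonneg[OF Q(1), of y] positive_map_nonneg[OF R, of y] by linarith+
    then have "Q y = 0" "R y = 0" using positive_map_eq_0 Q(1) R by blast+
    then have "cinner (Q x - R x) y = 0"
      by (simp add: cinner_simps positive_map_sym[OF Q(1)] positive_map_sym[OF R])
    then have "cinner y y = 0" by (simp only: y_def)
    then have "y = 0" by (simp add: cinner_self_eq_norm)
    then show ?thesis by (simp add: y_def)
  qed
  show ?thesis
  proof
    fix x
    have "S x = Q x" by (rule root[OF S]) (simp add: L_def)
    moreover have "R x = Q x" by (rule root[OF R]) (simp add: L_def eq)
    ultimately show "S x = R x" by simp
  qed
qed


section \<open>Operators as graphs\<close>

lemma app_eq: "single_valued S \<Longrightarrow> (f, g) \<in> S \<Longrightarrow> app S f = g"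
  by (auto simp: app_def single_valued_def)

lemma app_mem: "single_valued S \<Longrightarrow> f \<in> Domain S \<Longrightarrow> (f, app S f) \<in> S"
  using app_eq by fastforce

lemma linear_operator_single_valued: "linear_operator S \<Longrightarrow> single_valued S"
  by (simp add: linear_operator_def)

lemma csubspace_Domain: "csubspace S \<Longrightarrow> csubspace (Domain S)"
  using complex_vector.subspace_0[of S] complex_vector.subspace_add[of S "(_, _)" "(_, _)"]
    complex_vector.subspace_scale[of S "(_, _)"]
  unfolding complex_vector.subspace_def[of "Domain S"]
  by (fastforce simp: zero_prod_def scaleC_prod_def)

lemma clinear_on_app:
  assumes "linear_operator S"
  shows "clinear_on (Domain S) (app S)"
proof -
  have S: "csubspace S" "single_valued S" using assms by (auto simp: linear_operator_def)
  show ?thesis unfolding clinear_on_def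
  proof (intro conjI ballI allI)
    fix x y assume "x \<in> Domain S" "y \<in> Domain S"
    then have "(x, app S x) + (y, app S y) \<in> S"
      using S by (intro complex_vector.subspace_add app_mem)
    then show "app S (x + y) = app S x + app S y" using app_eq[OF S(2)] by simp
  next
    fix a x assume "x \<in> Domain S"
    then have "a *\<^sub>C (x, app S x) \<in> S" using S by (intro complex_vector.subspace_scale app_mem)
    then show "app S (a *\<^sub>C x) = a *\<^sub>C app S x" using app_eq[OF S(2)] by (simp add: scaleC_prod_def)
  qed
qed

abbreviation graph_of :: "('a \<Rightarrow> 'b) \<Rightarrow> ('a, 'b) graph" where
  "graph_of f \<equiv> range (\<lambda>x. (x, f x))"

lemma adjoint_graph_of_symmetric:
  assumes "\<And>x y. cinner (L x) y = cinner x (L y)"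
  shows "adjoint_op (graph_of L) = graph_of L"
proof -
  have "y' = L y" if "\<And>x. cinner x (L y) = cinner x y'" for y y'
    using that cinner_eqI cinner_commute by metis
  then show ?thesis by (auto simp: adjoint_op_def assms)
qed

lemma self_adjoint_graph_of:
  assumes "\<And>x y. cinner (L x) y = cinner x (L y)" "\<And>x y. L (x + y) = L x + L y"
  shows "self_adjoint (graph_of L)"
proof -
  have "L (a *\<^sub>C x) = a *\<^sub>C L x" for a x
    by (rule cinner_eqI) (simp add: assms(1) cinner_simps)
  moreover have "L 0 = 0" using assms(2)[of 0 0] by simp
  moreover have "Domain (graph_of L) = UNIV" by auto
  ultimately show ?thesis
    using adjoint_graph_of_symmetric[OF assms(1)] assms(2)
    by (auto simp: self_adjoint_def linear_operator_def densely_defined_def single_valued_def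
        complex_vector.subspace_def zero_prod_def scaleC_prod_def image_iff)
qed

text \<open>A self-adjoint non-negative root \<open>R\<close> of an everywhere defined bounded \<open>L\<close>, a priori
  unbounded, is everywhere defined because its square is, and it is bounded because
  \<open>(norm (R x))\<^sup>2 = (x, L x)\<close>. So uniqueness
  among all self-adjoint operators reduces to the bounded case.\<close>

lemma sqrt_op_graph_of:
  assumes L: "positive_map L"
  obtains S where "positive_map S" "\<And>x. S (S x) = L x" "sqrt_op (graph_of L) = graph_of S"
proof -
  obtain S where S: "positive_map S" "\<And>x. S (S x) = L x"
    by (rule positive_map_sqrt_exists[OF L]) (rule that)
  have "sqrt_op (graph_of L) = graph_of S"
    unfolding sqrt_op_def
  proof (rule the_equality)
    have "Im (cinner (S x) x) = 0" for x
      using cinner_commute[of "S x" x] by (simp add: positive_map_sym[OF S(1)] complex_eq_iff)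
    moreover have "graph_of S O graph_of S = graph_of L" using S(2) by (auto simp: relcomp_unfold image_iff)
    ultimately show "self_adjoint (graph_of S) \<and> nonnegative_op (graph_of S) \<and> graph_of S O graph_of S = graph_of L"
      using S positive_map_sym[OF S(1)] positive_map_nonneg[OF S(1)]
        bounded_linear.linear[OF positive_map_linear[OF S(1)]]
      by (auto simp: nonnegative_op_def linear_add intro!: self_adjoint_graph_of)
  next
    fix R assume R: "self_adjoint R \<and> nonnegative_op R \<and> R O R = graph_of L"
    then have R': "linear_operator R" "single_valued R" "adjoint_op R = R"
      by (auto simp: self_adjoint_def linear_operator_def)
    have dom: "Domain R = UNIV" using R by (force simp: Domain_iff set_eq_iff)
    define r where "r = app R"
    have r: "(x, r x) \<in> R" for x unfolding r_def using R'(2) dom by (intro app_mem) auto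
    then have graph: "R = graph_of r"
      using R'(2) by (auto simp: single_valued_def image_iff)
    have rr: "r (r x) = L x" for x
    proof -
      have "(x, r (r x)) \<in> R O R" using r by blast
      then show ?thesis using R by auto
    qed
    have sym: "cinner (r x) y = cinner x (r y)" for x y
    proof -
      have "(y, r y) \<in> adjoint_op R" using r R'(3) by simp
      then show ?thesis using r[of x] by (auto simp: adjoint_op_def)
    qed
    have lin: "r (x + y) = r x + r y" "r (a *\<^sub>C x) = a *\<^sub>C r x" for x y a
      using clinear_on_app[OF R'(1)] dom by (auto simp: r_def clinear_on_def)
    obtain c where c: "0 < c" "\<And>x. norm (L x) \<le> c * norm x" using positive_map_bound[OF L] by blast
    have "norm (r x) \<le> norm x * sqrt c" for x
    proof -
      have "(norm (r x))\<^sup>2 = Re (cinner x (L x))" by (simp add: Re_cinner_self[symmetric] sym rr)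
      also have "\<dots> \<le> norm x * norm (L x)"
        using complex_Re_le_cmod Cauchy_Schwarz_cinner order_trans by blast
      also have "\<dots> \<le> norm x * (c * norm x)" by (intro mult_left_mono c) simp
      also have "\<dots> = (norm x * sqrt c)\<^sup>2" using c(1) by (simp add: power_mult_distrib power2_eq_square)
      finally have "(norm (r x))\<^sup>2 \<le> (norm x * sqrt c)\<^sup>2" .
      from power2_le_imp_le[OF this] show ?thesis using c(1) by simp
    qed
    then have "bounded_linear r"
      by (intro bounded_linear_intro) (auto simp: lin scaleR_scaleC)
    moreover have "0 \<le> Re (cinner (r x) x)" for x
      using R r[of x] by (auto simp: nonnegative_op_def)
    ultimately have "positive_map r" by (simp add: positive_map_def sym)
    then have "r = S" by (rule positive_map_sqrt_unique) (simp_all add: S rr)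
    then show "R = graph_of S" using graph by simp
  qed
  with S show thesis using that by blast
qed

section \<open>Bounded maps and their adjoints\<close>

lemma closure_restricted_graph:
  assumes "bounded_linear L" "closure D = UNIV"
  shows "closure ((\<lambda>x. (x, L x)) ` D) = graph_of L"
proof (rule antisym)
  have cont: "continuous_on UNIV L" using assms(1) by (simp add: linear_continuous_on)
  have "graph_of L = {p. L (fst p) = snd p}" by auto
  also have "closed \<dots>"
    by (intro closed_Collect_eq continuous_on_compose2[OF cont] continuous_intros) auto
  finally show "closure ((\<lambda>x. (x, L x)) ` D) \<subseteq> graph_of L"
    by (intro closure_minimal) auto
  have "continuous_on (closure D) (\<lambda>x. (x, L x))"
    using assms(2) cont by (auto intro!: continuous_intros)
  then show "graph_of L \<subseteq> closure ((\<lambda>x. (x, L x)) ` D)"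
    using image_closure_subset[OF _ closed_closure closure_subset, of D "\<lambda>x. (x, L x)"] assms(2) by simp
qed

definition adjoint_pair :: "('a::chilbert_space \<Rightarrow> 'b::chilbert_space) \<Rightarrow> ('b \<Rightarrow> 'a) \<Rightarrow> bool" where
  "adjoint_pair K C \<longleftrightarrow> (\<forall>h x. cinner (K h) x = cinner h (C x))"

lemma adjoint_pairD: "adjoint_pair K C \<Longrightarrow> cinner (K h) x = cinner h (C x)"
  by (simp add: adjoint_pair_def)

lemma adjoint_pairD': "adjoint_pair K C \<Longrightarrow> cinner x (K h) = cinner (C x) h"
  by (metis adjoint_pair_def cinner_commute)

lemma adjoint_pair_sym: "adjoint_pair K C \<Longrightarrow> adjoint_pair C K"
  by (metis adjoint_pair_def cinner_commute)

lemma adjoint_pair_add: "adjoint_pair K C \<Longrightarrow> K (x + y) = K x + K y"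
  and adjoint_pair_diff: "adjoint_pair K C \<Longrightarrow> K (x - y) = K x - K y"
  and adjoint_pair_scaleC: "adjoint_pair K C \<Longrightarrow> K (a *\<^sub>C x) = a *\<^sub>C K x"
  by (rule cinner_eqI, simp add: adjoint_pairD cinner_simps)+

text \<open>Douglas' range inclusion: \<open>Q' v \<mapsto> (v, P x)\<close> is well defined and bounded by \<open>norm x\<close>
  on the range of \<open>Q'\<close>, and a representing vector is a solution \<open>y\<close> of \<open>Q y = P x\<close>.\<close>

theorem douglas_range_inclusion:
  assumes P: "adjoint_pair P P'" and Q: "adjoint_pair Q Q'"
    and le: "\<And>v. norm (P' v) \<le> norm (Q' v)"
  obtains y where "P x = Q y" "norm y \<le> norm x"
proof -
  note P' = adjoint_pair_sym[OF P] and Q' = adjoint_pair_sym[OF Q]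
  define f where "f u = cinner (P' (SOME v. Q' v = u)) x" for u
  have f: "f (Q' v) = cinner (P' v) x" for v
  proof -
    have "Q' (SOME w. Q' w = Q' v) = Q' v" by (rule someI) simp
    then have "P' (SOME w. Q' w = Q' v) = P' v"
      using le[of "(SOME w. Q' w = Q' v) - v"] by (simp add: adjoint_pair_diff[OF P'] adjoint_pair_diff[OF Q'])
    then show ?thesis by (simp add: f_def)
  qed
  have sub: "csubspace (range Q')"
    unfolding complex_vector.subspace_def
    by (auto simp: image_iff) (metis Q' adjoint_pair_diff diff_self,
      metis Q' adjoint_pair_add, metis Q' adjoint_pair_scaleC)
  have lin: "clinear_on (range Q') f"
    unfolding clinear_on_def
    by (auto simp: f cinner_simps adjoint_pair_add[OF P'] adjoint_pair_scaleC[OF P'] scaleC_complex_def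
        simp flip: adjoint_pair_add[OF Q'] adjoint_pair_scaleC[OF Q'])
  have "cmod (f u) \<le> norm x * norm u" if u: "u \<in> range Q'" for u
  proof -
    obtain v where v: "u = Q' v" using u by blast
    have "cmod (f u) \<le> norm (P' v) * norm x" by (simp add: v f Cauchy_Schwarz_cinner)
    also have "\<dots> \<le> norm u * norm x" unfolding v by (intro mult_right_mono le) simp
    finally show ?thesis by (simp add: mult.commute)
  qed
  then obtain y where y: "\<forall>u\<in>range Q'. f u = cinner u y" "norm y \<le> norm x"
    using riesz_representation[OF sub lin, of "norm x"] by auto
  have "cinner (P x) v = cinner (Q y) v" for v
  proof -
    have "cinner (P' v) x = cinner (Q' v) y" using y(1) f by simp
    then show ?thesis using P' Q' by (metis adjoint_pairD cinner_commute)
  qed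
  then have "P x = Q y" by (rule cinner_eqI)
  then show thesis using y(2) that by blast
qed

lemma adjoint_pair_exists:
  assumes K: "bounded_linear K" "clinear_on UNIV K"
  obtains C where "adjoint_pair K C" "bounded_linear C"
proof -
  obtain c where c: "0 < c" "\<And>h. norm (K h) \<le> c * norm h"
    using bounded_linear.pos_bounded[OF K(1)] by (auto simp: mult.commute)
  have "\<exists>z. (\<forall>h. cinner (K h) x = cinner h z) \<and> norm z \<le> c * norm x" for x
  proof -
    have "cmod (cinner (K h) x) \<le> (c * norm x) * norm h" for h
    proof -
      have "cmod (cinner (K h) x) \<le> norm (K h) * norm x" by (rule Cauchy_Schwarz_cinner)
      also have "\<dots> \<le> (c * norm h) * norm x" by (intro mult_right_mono c) simp
      finally show ?thesis by (simp add: mult_ac)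
    qed
    moreover have "clinear_on UNIV (\<lambda>h. cinner (K h) x)"
      using K(2) by (simp add: clinear_on_def cinner_simps scaleC_complex_def)
    ultimately show ?thesis
      using riesz_representation[OF complex_vector.subspace_UNIV, of "\<lambda>h. cinner (K h) x" "c * norm x"] c(1)
      by (metis UNIV_I less_imp_le mult_nonneg_nonneg norm_ge_zero)
  qed
  then obtain C where C: "\<And>x h. cinner (K h) x = cinner h (C x)" "\<And>x. norm (C x) \<le> c * norm x"
    by metis
  then have pair: "adjoint_pair K C" by (simp add: adjoint_pair_def)
  note lin = adjoint_pair_add[OF adjoint_pair_sym[OF pair]] adjoint_pair_scaleC[OF adjoint_pair_sym[OF pair]]
  have "bounded_linear C"
    by (rule bounded_linear_intro[of _ c]) (use C(2) in \<open>auto simp: lin scaleR_scaleC mult.commute\<close>)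
  with pair show thesis using that by blast
qed


section \<open>Self-adjoint operators and their resolvents\<close>

lemma clinear_on_shift:
  assumes "linear_operator S"
  shows "clinear_on (Domain S) (\<lambda>f. app S f - \<mu> *\<^sub>C f)"
  using clinear_on_app[OF assms]
  by (auto simp: clinear_on_def scaleC_add_right complex_vector.scale_right_diff_distrib
      scaleC_scaleC mult.commute)

lemma csubspace_image:
  assumes "csubspace V" "clinear_on V f"
  shows "csubspace (f ` V)"
  unfolding complex_vector.subspace_def
proof (intro conjI ballI allI)
  note V = complex_vector.subspace_0[OF assms(1)] complex_vector.subspace_add[OF assms(1)]
    complex_vector.subspace_scale[OF assms(1)]
  have "f 0 = 0" using clinear_on_scaleC[OF assms(2) V(1), of 0] by simp
  then show "0 \<in> f ` V" using V(1) by force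
  fix x assume "x \<in> f ` V"
  then obtain v where v: "v \<in> V" "x = f v" by blast
  show "a *\<^sub>C x \<in> f ` V" for a
    using clinear_on_scaleC[OF assms(2) v(1), of a, symmetric] V(3)[OF v(1)] v(2) by simp
  fix y assume "y \<in> f ` V"
  then obtain w where w: "w \<in> V" "y = f w" by blast
  show "x + y \<in> f ` V"
    using clinear_on_add[OF assms(2) v(1) w(1), symmetric] V(2)[OF v(1) w(1)] v(2) w(2) by simp
qed

lemma linear_operator_Domain: "linear_operator S \<Longrightarrow> csubspace (Domain S)"
  by (simp add: linear_operator_def csubspace_Domain)

lemma inj_on_shift:
  assumes S: "linear_operator S" and "\<And>f. f \<in> Domain S \<Longrightarrow> app S f - \<mu> *\<^sub>C f = 0 \<Longrightarrow> f = 0"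
  shows "inj_on (\<lambda>f. app S f - \<mu> *\<^sub>C f) (Domain S)"
proof (rule inj_onI)
  fix f g assume fg: "f \<in> Domain S" "g \<in> Domain S" "app S f - \<mu> *\<^sub>C f = app S g - \<mu> *\<^sub>C g"
  then have "app S (f - g) - \<mu> *\<^sub>C (f - g) = 0"
    using clinear_on_diff[OF linear_operator_Domain[OF S] clinear_on_shift[OF S] fg(1,2)] by simp
  then have "f - g = 0"
    using assms(2) complex_vector.subspace_diff[OF linear_operator_Domain[OF S] fg(1,2)] by blast
  then show "f = g" by simp
qed

lemma self_adjoint_linear: "self_adjoint S \<Longrightarrow> linear_operator S"
  by (simp add: self_adjoint_def)

lemma self_adjoint_app:
  assumes S: "self_adjoint S" and fg: "f \<in> Domain S" "g \<in> Domain S"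
  shows "cinner (app S f) g = cinner f (app S g)"
proof -
  note mem = app_mem[OF linear_operator_single_valued[OF self_adjoint_linear[OF S]]]
  have "(g, app S g) \<in> adjoint_op S" using S mem[OF fg(2)] by (simp add: self_adjoint_def)
  then show ?thesis using mem[OF fg(1)] by (auto simp: adjoint_op_def)
qed

lemma self_adjoint_memI:
  assumes S: "self_adjoint S" and "\<And>g. g \<in> Domain S \<Longrightarrow> cinner (app S g) f = cinner g f'"
  shows "f \<in> Domain S" "app S f = f'"
proof -
  have sv: "single_valued S" using S by (simp add: self_adjoint_def linear_operator_def)
  have "(f, f') \<in> adjoint_op S"
    using assms(2) app_eq[OF sv] by (fastforce simp: adjoint_op_def)
  then have "(f, f') \<in> S" using S by (simp add: self_adjoint_def)
  then show "f \<in> Domain S" "app S f = f'" using app_eq[OF sv] by auto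
qed

text \<open>If \<open>S - cnj \<mu>\<close> is bounded below, then \<open>(S - cnj \<mu>) g \<mapsto> (g, h)\<close> is a bounded functional on its
  range; a representing vector lies in the domain of the adjoint of \<open>S\<close> and solves
  \<open>(S - \<mu>) z = h\<close>.\<close>

lemma self_adjoint_shift_surj:
  assumes S: "self_adjoint S" and c: "0 \<le> c"
    and below: "\<And>g. g \<in> Domain S \<Longrightarrow> norm g \<le> c * norm (app S g - cnj \<mu> *\<^sub>C g)"
  obtains z where "z \<in> Domain S" "app S z - \<mu> *\<^sub>C z = h"
proof -
  note lin = self_adjoint_linear[OF S]
  let ?B = "\<lambda>g. app S g - cnj \<mu> *\<^sub>C g"
  note B = clinear_on_shift[OF lin, of "cnj \<mu>"]
  have inj: "inj_on ?B (Domain S)" using below by (intro inj_on_shift lin) fastforce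
  define f where "f v = cinner (the_inv_into (Domain S) ?B v) h" for v
  have f: "f (?B g) = cinner g h" if "g \<in> Domain S" for g
    using the_inv_into_f_f[OF inj that] by (simp add: f_def)
  have lin_f: "clinear_on (?B ` Domain S) f"
    unfolding clinear_on_def
  proof (intro conjI ballI allI; elim imageE)
    fix u v x y assume "x \<in> Domain S" "u = ?B x" "y \<in> Domain S" "v = ?B y"
    then show "f (u + v) = f u + f v"
      using f[of "x + y"] f[of x] f[of y] clinear_on_add[OF B, of x y]
        complex_vector.subspace_add[OF linear_operator_Domain[OF lin], of x y]
      by (simp add: cinner_simps)
  next
    fix a u x assume "x \<in> Domain S" "u = ?B x"
    then show "f (a *\<^sub>C u) = a *\<^sub>C f u"
      using f[of "a *\<^sub>C x"] f[of x] clinear_on_scaleC[OF B, of x a]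
        complex_vector.subspace_scale[OF linear_operator_Domain[OF lin], of x a]
      by (simp add: cinner_simps scaleC_complex_def)
  qed
  have bound_f: "cmod (f v) \<le> (c * norm h) * norm v" if v: "v \<in> ?B ` Domain S" for v
  proof -
    obtain g where g: "g \<in> Domain S" "v = ?B g" using v by blast
    have "cmod (f v) \<le> norm g * norm h" by (simp add: g f[OF g(1)] Cauchy_Schwarz_cinner)
    also have "\<dots> \<le> (c * norm v) * norm h" using below[OF g(1)] g(2) by (intro mult_right_mono) auto
    finally show ?thesis by (simp add: mult_ac)
  qed
  obtain z where z: "\<forall>v \<in> ?B ` Domain S. f v = cinner v z"
    by (rule riesz_representation[OF csubspace_image[OF linear_operator_Domain[OF lin] B] lin_f bound_f
        mult_nonneg_nonneg[OF c norm_ge_zero]]) (assumption, rule that)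
  have "cinner (app S g) z = cinner g (h + \<mu> *\<^sub>C z)" if g: "g \<in> Domain S" for g
  proof -
    have "cinner (?B g) z = cinner g h" using bspec[OF z imageI[OF g]] f[OF g] by simp
    then show ?thesis by (simp add: cinner_simps algebra_simps)
  qed
  from self_adjoint_memI[OF S this] show thesis using that by auto
qed

lemma resolvent_Domain: "\<mu> \<in> resolvent_set S \<Longrightarrow> resolvent S \<mu> h \<in> Domain S"
  unfolding resolvent_set_def resolvent_def bij_betw_def by (auto intro!: the_inv_into_into)

lemma app_resolvent: "\<mu> \<in> resolvent_set S \<Longrightarrow> app S (resolvent S \<mu> h) = h + \<mu> *\<^sub>C resolvent S \<mu> h"
  using f_the_inv_into_f[of "\<lambda>f. app S f - \<mu> *\<^sub>C f" "Domain S" h]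
  by (auto simp: resolvent_set_def resolvent_def bij_betw_def algebra_simps)

lemma resolvent_shift:
  "\<mu> \<in> resolvent_set S \<Longrightarrow> f \<in> Domain S \<Longrightarrow> resolvent S \<mu> (app S f - \<mu> *\<^sub>C f) = f"
  using the_inv_into_f_f[of "\<lambda>f. app S f - \<mu> *\<^sub>C f" "Domain S" f]
  by (simp add: resolvent_set_def resolvent_def bij_betw_def)

lemma clinear_on_resolvent:
  assumes S: "linear_operator S" and \<mu>: "\<mu> \<in> resolvent_set S"
  shows "clinear_on UNIV (resolvent S \<mu>)"
  unfolding clinear_on_def
proof (intro conjI ballI allI)
  note dom = linear_operator_Domain[OF S] and B = clinear_on_shift[OF S, of \<mu>]
  note R = resolvent_Domain[OF \<mu>] app_resolvent[OF \<mu>]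
  fix x y a
  have "resolvent S \<mu> x + resolvent S \<mu> y \<in> Domain S"
    using R(1) dom by (intro complex_vector.subspace_add)
  from resolvent_shift[OF \<mu> this] show "resolvent S \<mu> (x + y) = resolvent S \<mu> x + resolvent S \<mu> y"
    using clinear_on_add[OF B R(1) R(1), of x y] by (simp add: R(2))
  have "a *\<^sub>C resolvent S \<mu> x \<in> Domain S"
    using R(1) dom by (intro complex_vector.subspace_scale)
  from resolvent_shift[OF \<mu> this] show "resolvent S \<mu> (a *\<^sub>C x) = a *\<^sub>C resolvent S \<mu> x"
    using clinear_on_scaleC[OF B R(1), of a x] by (simp add: R(2))
qed

lemma resolvent_bound:
  assumes S: "linear_operator S" and \<mu>: "\<mu> \<in> resolvent_set S"
  obtains c where "0 < c" "\<And>h. norm (resolvent S \<mu> h) \<le> c * norm h"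
proof -
  have "norm_continuous_on UNIV norm norm (resolvent S \<mu>)"
    using \<mu> by (simp add: resolvent_set_def continuous_on_iff norm_continuous_on_def dist_norm)
  then show thesis
    using that norm_continuous_on_imp_bounded[OF complex_vector.subspace_UNIV is_norm_on_norm
        is_norm_on_norm[of UNIV], of "resolvent S \<mu>"] clinear_on_scaleC[OF clinear_on_resolvent[OF assms]]
    by auto
qed

lemma resolvent_below:
  assumes S: "linear_operator S" and \<mu>: "\<mu> \<in> resolvent_set S"
  obtains c where "0 < c" "\<And>f. f \<in> Domain S \<Longrightarrow> norm f \<le> c * norm (app S f - \<mu> *\<^sub>C f)"
  using resolvent_bound[OF assms] resolvent_shift[OF \<mu>] by metis

lemma resolvent_setI:
  assumes S: "linear_operator S"
    and below: "\<And>f. f \<in> Domain S \<Longrightarrow> norm f \<le> c * norm (app S f - \<mu> *\<^sub>C f)"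
    and surj: "\<And>h. \<exists>f\<in>Domain S. app S f - \<mu> *\<^sub>C f = h"
  shows "\<mu> \<in> resolvent_set S"
proof -
  let ?B = "\<lambda>f. app S f - \<mu> *\<^sub>C f"
  have inj: "inj_on ?B (Domain S)" using below by (intro inj_on_shift S) fastforce
  have R: "resolvent S \<mu> (?B f) = f" if "f \<in> Domain S" for f
    using the_inv_into_f_f[OF inj that] by (simp add: resolvent_def)
  have "norm (resolvent S \<mu> x - resolvent S \<mu> y) \<le> c * norm (x - y)" for x y
  proof -
    obtain f g where fg: "f \<in> Domain S" "x = ?B f" "g \<in> Domain S" "y = ?B g" using surj by metis
    then show ?thesis
      using below[OF complex_vector.subspace_diff[OF linear_operator_Domain[OF S] fg(1,3)]]
        clinear_on_diff[OF linear_operator_Domain[OF S] clinear_on_shift[OF S] fg(1,3), of \<mu>] R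
      by simp
  qed
  then have lip: "dist (resolvent S \<mu> x) (resolvent S \<mu> y) \<le> \<bar>c\<bar> * dist x y" for x y
    by (metis abs_ge_self dist_norm mult_right_mono norm_ge_zero order_trans)
  then have "\<bar>c\<bar>-lipschitz_on UNIV (resolvent S \<mu>)" by (simp add: lipschitz_on_def)
  then have "continuous_on UNIV (resolvent S \<mu>)" by (rule lipschitz_on_continuous_on)
  moreover have "h \<in> ?B ` Domain S" for h using surj[of h] by auto
  then have "bij_betw ?B (Domain S) UNIV" using inj by (auto simp: bij_betw_def)
  ultimately show ?thesis by (simp add: resolvent_set_def)
qed

text \<open>As \<open>(S f, f)\<close> is real, the imaginary part of \<open>((S - \<nu>) f, f)\<close> is \<open>- Im \<nu> * (norm f)\<^sup>2\<close>. So
  \<open>S - \<nu>\<close> is bounded below for \<open>\<nu> = \<mu>\<close>, which gives a bounded inverse, and for \<open>\<nu> = cnj \<mu>\<close>, which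
  gives surjectivity.\<close>

lemma resolvent_set_nonreal:
  assumes S: "self_adjoint S" and \<mu>: "Im \<mu> \<noteq> 0"
  shows "\<mu> \<in> resolvent_set S"
proof -
  have below: "norm f \<le> (1 / \<bar>Im \<nu>\<bar>) * norm (app S f - \<nu> *\<^sub>C f)"
    if f: "f \<in> Domain S" and \<nu>: "Im \<nu> \<noteq> 0" for f \<nu>
  proof -
    have "Im (cinner (app S f) f) = 0"
      using self_adjoint_app[OF S f f] cinner_commute[of "app S f" f] by (simp add: complex_eq_iff)
    then have "Im (cinner (app S f - \<nu> *\<^sub>C f) f) = - (Im \<nu> * (norm f)\<^sup>2)"
      by (simp add: cinner_simps Re_cinner_self)
    then have "\<bar>Im \<nu>\<bar> * (norm f)\<^sup>2 \<le> cmod (cinner (app S f - \<nu> *\<^sub>C f) f)"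
      using abs_Im_le_cmod[of "cinner (app S f - \<nu> *\<^sub>C f) f"] by (simp add: abs_mult)
    also have "\<dots> \<le> norm (app S f - \<nu> *\<^sub>C f) * norm f" by (rule Cauchy_Schwarz_cinner)
    finally have "\<bar>Im \<nu>\<bar> * norm f \<le> norm (app S f - \<nu> *\<^sub>C f)"
      by (cases "f = 0") (auto simp: power2_eq_square simp flip: mult.assoc)
    then show ?thesis using \<nu> by (simp add: field_simps)
  qed
  show ?thesis
  proof (rule resolvent_setI[OF self_adjoint_linear[OF S] below[OF _ \<mu>]])
    show "\<exists>f\<in>Domain S. app S f - \<mu> *\<^sub>C f = h" for h
      by (rule self_adjoint_shift_surj[OF S _ below[of _ "cnj \<mu>"]]) (use \<mu> in auto)
  qed auto
qed

text \<open>The resolvent set is symmetric about the real axis: the resolvent at \<open>cnj \<mu>\<close> is the adjoint of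
  the resolvent at \<open>\<mu>\<close> and therefore has the same bound.\<close>

lemma resolvent_set_cnj:
  assumes S: "self_adjoint S" and \<mu>: "\<mu> \<in> resolvent_set S"
  shows "cnj \<mu> \<in> resolvent_set S"
proof -
  note lin = self_adjoint_linear[OF S]
  obtain c where c: "0 < c" "\<And>f. f \<in> Domain S \<Longrightarrow> norm f \<le> c * norm (app S f - \<mu> *\<^sub>C f)"
    using resolvent_below[OF lin \<mu>] by blast
  have "norm f \<le> c * norm (app S f - cnj \<mu> *\<^sub>C f)" if f: "f \<in> Domain S" for f
  proof -
    define g where "g = resolvent S \<mu> f"
    have g: "g \<in> Domain S" "app S g = f + \<mu> *\<^sub>C g"
      using resolvent_Domain[OF \<mu>] app_resolvent[OF \<mu>] by (auto simp: g_def)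
    have "cinner (app S f - cnj \<mu> *\<^sub>C f) g = cinner f f"
      by (simp add: cinner_simps self_adjoint_app[OF S f g(1)] g(2))
    then have "(norm f)\<^sup>2 \<le> norm (app S f - cnj \<mu> *\<^sub>C f) * norm g"
      using Cauchy_Schwarz_cinner[of "app S f - cnj \<mu> *\<^sub>C f" g] by (simp add: cinner_self_eq_norm norm_power)
    also have "\<dots> \<le> norm (app S f - cnj \<mu> *\<^sub>C f) * (c * norm f)"
      using c(2)[OF g(1)] g(2) by (intro mult_left_mono) auto
    finally show ?thesis using c(1) by (cases "f = 0") (auto simp: power2_eq_square mult_ac)
  qed
  moreover have "\<exists>f\<in>Domain S. app S f - cnj \<mu> *\<^sub>C f = h" for h
    by (rule self_adjoint_shift_surj[OF S, of c "cnj \<mu>" h]) (use c in auto)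
  ultimately show ?thesis by (rule resolvent_setI[OF lin])
qed

lemma resolvent_identity:
  assumes S: "linear_operator S" and \<mu>: "\<mu> \<in> resolvent_set S" and \<nu>: "\<nu> \<in> resolvent_set S"
  shows "resolvent S \<nu> h = resolvent S \<mu> (h + (\<nu> - \<mu>) *\<^sub>C resolvent S \<nu> h)"
  using resolvent_shift[OF \<mu> resolvent_Domain[OF \<nu>, of h]]
  by (simp add: app_resolvent[OF \<nu>] complex_vector.scale_left_diff_distrib add_diff_eq)

section \<open>Quasi boundary triples\<close>

lemma adjoint_single_valued:
  assumes "densely_defined A"
  shows "single_valued (adjoint_op A)"
proof (rule single_valuedI)
  fix g g' g'' assume "(g, g') \<in> adjoint_op A" "(g, g'') \<in> adjoint_op A"
  then have "cinner (g' - g'') f = 0" if "f \<in> Domain A" for f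
  proof -
    have "cinner f g' = cinner f g''"
      using that \<open>(g, g') \<in> adjoint_op A\<close> \<open>(g, g'') \<in> adjoint_op A\<close> by (fastforce simp: adjoint_op_def)
    then show ?thesis by (metis cinner_commute cinner_diff_left right_minus_eq)
  qed
  then have "g' - g'' = 0" using assms by (intro orthogonal_dense_imp_zero[of "Domain A"]) (auto simp: densely_defined_def)
  then show "g' = g''" by simp
qed

lemma csubspace_adjoint: "csubspace (adjoint_op A)"
  unfolding complex_vector.subspace_def
  by (auto simp: adjoint_op_def zero_prod_def scaleC_prod_def cinner_simps split: prod.splits)

locale quasi_triple =
  fixes A T :: "('h::chilbert_space, 'h) graph" and \<Gamma>0 \<Gamma>1 :: "'h \<Rightarrow> 'g::chilbert_space"
  assumes A_dense: "densely_defined A" and triple: "quasi_boundary_triple A T \<Gamma>0 \<Gamma>1"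
begin

abbreviation A0 :: "('h, 'h) graph" where "A0 \<equiv> restrict_to_ker T \<Gamma>0"
abbreviation As :: "('h, 'h) graph" where "As \<equiv> adjoint_op A"

lemma linear_T: "linear_operator T" and T_sub: "T \<subseteq> As" and closure_T: "closure T = As"
  and clinear_\<Gamma>0: "clinear_on (Domain T) \<Gamma>0" and clinear_\<Gamma>1: "clinear_on (Domain T) \<Gamma>1"
  and green: "f \<in> Domain T \<Longrightarrow> g \<in> Domain T \<Longrightarrow>
    cinner (app T f) g - cinner f (app T g) = cinner (\<Gamma>1 f) (\<Gamma>0 g) - cinner (\<Gamma>0 f) (\<Gamma>1 g)"
  and range_dense: "closure ((\<lambda>f. (\<Gamma>0 f, \<Gamma>1 f)) ` Domain T) = UNIV"
  and A0_self_adjoint: "self_adjoint A0"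
  using triple unfolding quasi_boundary_triple_def by blast+

lemmas single_valued_T = linear_operator_single_valued[OF linear_T]
lemmas A0_linear = self_adjoint_linear[OF A0_self_adjoint]
lemmas Domain_T = linear_operator_Domain[OF linear_T]

lemma T_app: "f \<in> Domain T \<Longrightarrow> (f, app T f) \<in> T"
  by (rule app_mem[OF single_valued_T])

lemma single_valued_As: "single_valued As" by (rule adjoint_single_valued[OF A_dense])

lemma linear_As: "linear_operator As"
  using single_valued_As csubspace_adjoint by (simp add: linear_operator_def)

lemma As_app: "f \<in> Domain As \<Longrightarrow> (f, app As f) \<in> As"
  by (rule app_mem[OF single_valued_As])

lemma Domain_A0: "Domain A0 = ker_on T \<Gamma>0"
  by (auto simp: restrict_to_ker_def ker_on_def)

lemma kerD: "u \<in> ker_on T \<Gamma>0 \<Longrightarrow> u \<in> Domain T" "u \<in> ker_on T \<Gamma>0 \<Longrightarrow> \<Gamma>0 u = 0"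
  by (auto simp: ker_on_def)

lemma csubspace_ker: "csubspace (ker_on T \<Gamma>0)"
  using linear_operator_Domain[OF A0_linear] by (simp add: Domain_A0)

lemma app_A0:
  assumes u: "u \<in> ker_on T \<Gamma>0"
  shows "app A0 u = app T u"
proof (rule app_eq)
  show "single_valued A0" using A0_linear by (simp add: linear_operator_def)
  show "(u, app T u) \<in> A0" using u T_app[OF kerD(1)[OF u]] by (simp add: restrict_to_ker_def)
qed

lemma app_As_T: "f \<in> Domain T \<Longrightarrow> app As f = app T f"
  using T_app T_sub app_eq[OF single_valued_As] by blast

lemma green_ker:
  assumes u: "u \<in> ker_on T \<Gamma>0" and g: "g \<in> Domain T"
  shows "cinner (app T u) g - cinner u (app T g) = cinner (\<Gamma>1 u) (\<Gamma>0 g)"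
    "cinner g (app T u) - cinner (app T g) u = cinner (\<Gamma>0 g) (\<Gamma>1 u)"
proof -
  show eq: "cinner (app T u) g - cinner u (app T g) = cinner (\<Gamma>1 u) (\<Gamma>0 g)"
    using green[OF kerD(1)[OF u] g] kerD(2)[OF u] by simp
  show "cinner g (app T u) - cinner (app T g) u = cinner (\<Gamma>0 g) (\<Gamma>1 u)"
    using arg_cong[OF eq, of cnj] by (simp flip: cinner_commute)
qed

lemma range_\<Gamma>0_dense: "closure (\<Gamma>0 ` Domain T) = UNIV"
proof -
  have "x \<in> closure (\<Gamma>0 ` Domain T)" for x
  proof -
    have "(x, 0) \<in> closure ((\<lambda>f. (\<Gamma>0 f, \<Gamma>1 f)) ` Domain T)" using range_dense by simp
    then have "fst (x, 0::'g) \<in> closure (fst ` (\<lambda>f. (\<Gamma>0 f, \<Gamma>1 f)) ` Domain T)"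
      using closure_bounded_linear_image_subset[OF bounded_linear_fst] by blast
    then show ?thesis by (simp add: image_image)
  qed
  then show ?thesis by blast
qed

text \<open>Elements of the domain of \<open>A\<close> are annihilated by both boundary maps: \<open>A\<close> is contained in the
  adjoint of \<open>A0\<close>, which is \<open>A0\<close> itself, and then Green's identity shows that \<open>\<Gamma>1 a\<close> is orthogonal
  to the dense range of \<open>\<Gamma>0\<close>.\<close>

lemma A_boundary_values:
  assumes a: "(a, a') \<in> A"
  shows "a \<in> ker_on T \<Gamma>0" "app T a = a'" "\<Gamma>1 a = 0"
proof -
  have dual: "cinner a' g = cinner a (app T g)" if "g \<in> Domain T" for g
    using a T_app[OF that] T_sub by (auto simp: adjoint_op_def)
  have "cinner (app A0 g) a = cinner g a'" if "g \<in> Domain A0" for g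
    using that dual[of g] kerD(1)[of g] app_A0[of g] by (metis Domain_A0 cinner_commute)
  from self_adjoint_memI[OF A0_self_adjoint this] show ker: "a \<in> ker_on T \<Gamma>0" and app: "app T a = a'"
    by (auto simp: Domain_A0 app_A0)
  have "cinner (\<Gamma>1 a) x = 0" if "x \<in> \<Gamma>0 ` Domain T" for x
    using that green_ker(1)[OF ker] dual app by auto
  then show "\<Gamma>1 a = 0" using orthogonal_dense_imp_zero[OF range_\<Gamma>0_dense] by blast
qed

lemma i_resolvent: "\<i> \<in> resolvent_set A0" "- \<i> \<in> resolvent_set A0"
  by (simp_all add: resolvent_set_nonreal[OF A0_self_adjoint])


section \<open>The gamma field and its adjoint\<close>

definition gamma_adj :: "complex \<Rightarrow> 'h \<Rightarrow> 'g" where "gamma_adj \<mu> h = \<Gamma>1 (resolvent A0 \<mu> h)"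

lemma resolvent_ker: "\<mu> \<in> resolvent_set A0 \<Longrightarrow> resolvent A0 \<mu> h \<in> ker_on T \<Gamma>0"
  using resolvent_Domain Domain_A0 by blast

lemma app_T_resolvent:
  "\<mu> \<in> resolvent_set A0 \<Longrightarrow> app T (resolvent A0 \<mu> h) = h + \<mu> *\<^sub>C resolvent A0 \<mu> h"
  using app_resolvent[of \<mu> A0 h] app_A0[OF resolvent_ker] by simp

lemma clinear_gamma_adj:
  assumes "\<mu> \<in> resolvent_set A0"
  shows "clinear_on UNIV (gamma_adj \<mu>)"
  using clinear_on_resolvent[OF A0_linear assms] clinear_\<Gamma>1 kerD(1)[OF resolvent_ker[OF assms]]
  by (auto simp: clinear_on_def gamma_adj_def)

lemma range_gamma_adj:
  assumes "\<mu> \<in> resolvent_set A0"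
  shows "range (gamma_adj \<mu>) = \<Gamma>1 ` ker_on T \<Gamma>0"
proof -
  have "u \<in> range (resolvent A0 \<mu>)" if "u \<in> ker_on T \<Gamma>0" for u
    using resolvent_shift[OF assms, of u] that Domain_A0 by (metis rangeI)
  then show ?thesis using resolvent_ker[OF assms] by (fastforce simp: gamma_adj_def)
qed

lemma gamma_adj_identity:
  "\<mu> \<in> resolvent_set A0 \<Longrightarrow> \<nu> \<in> resolvent_set A0 \<Longrightarrow>
    gamma_adj \<nu> h = gamma_adj \<mu> (h + (\<nu> - \<mu>) *\<^sub>C resolvent A0 \<nu> h)"
  using resolvent_identity[OF A0_linear, of \<mu> \<nu> h] by (simp add: gamma_adj_def)

lemma eigenspace_\<Gamma>0_inj: "inj_on \<Gamma>0 (eigenspace T \<i>)"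
proof (rule inj_onI)
  fix f g assume fg: "f \<in> eigenspace T \<i>" "g \<in> eigenspace T \<i>" "\<Gamma>0 f = \<Gamma>0 g"
  then have T: "f \<in> Domain T" "g \<in> Domain T" by (auto simp: eigenspace_def)
  have "f - g \<in> ker_on T \<Gamma>0"
    using T fg(3) clinear_on_diff[OF Domain_T clinear_\<Gamma>0 T]
    by (simp add: ker_on_def complex_vector.subspace_diff[OF Domain_T])
  moreover have "app T (f - g) = \<i> *\<^sub>C (f - g)"
    using fg clinear_on_diff[OF Domain_T clinear_on_app[OF linear_T] T]
    by (simp add: eigenspace_def complex_vector.scale_right_diff_distrib)
  ultimately have "resolvent A0 \<i> 0 = f - g"
    using resolvent_shift[OF i_resolvent(1), of "f - g"] by (simp add: Domain_A0 app_A0)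
  moreover have "resolvent A0 \<i> 0 = 0"
    using clinear_on_scaleC[OF clinear_on_resolvent[OF A0_linear i_resolvent(1)], of 0 0] by simp
  ultimately show "f = g" by simp
qed

lemma \<Gamma>0_eigenspace: "\<Gamma>0 ` eigenspace T \<i> = \<Gamma>0 ` Domain T"
proof (rule antisym)
  show "\<Gamma>0 ` Domain T \<subseteq> \<Gamma>0 ` eigenspace T \<i>"
  proof (rule image_subsetI)
    fix f assume f: "f \<in> Domain T"
    define u where "u = resolvent A0 \<i> (app T f - \<i> *\<^sub>C f)"
    have u: "u \<in> ker_on T \<Gamma>0" "app T u = app T f - \<i> *\<^sub>C f + \<i> *\<^sub>C u"
      using resolvent_ker[OF i_resolvent(1)] app_T_resolvent[OF i_resolvent(1)] by (auto simp: u_def)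
    have "f - u \<in> eigenspace T \<i>"
      using f u kerD(1)[OF u(1)] clinear_on_diff[OF Domain_T clinear_on_app[OF linear_T], of f u]
      by (simp add: eigenspace_def complex_vector.subspace_diff[OF Domain_T]
          complex_vector.scale_right_diff_distrib)
    moreover have "\<Gamma>0 (f - u) = \<Gamma>0 f"
      using clinear_on_diff[OF Domain_T clinear_\<Gamma>0 f kerD(1)[OF u(1)]] kerD(2)[OF u(1)] by simp
    ultimately show "\<Gamma>0 f \<in> \<Gamma>0 ` eigenspace T \<i>"
      using imageI[of "f - u" "eigenspace T \<i>" \<Gamma>0] by simp
  qed
qed (auto simp: eigenspace_def)

lemma gamma_field:
  assumes "x \<in> \<Gamma>0 ` Domain T"
  shows "gamma_field T \<Gamma>0 \<i> x \<in> Domain T" "app T (gamma_field T \<Gamma>0 \<i> x) = \<i> *\<^sub>C gamma_field T \<Gamma>0 \<i> x"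
    "\<Gamma>0 (gamma_field T \<Gamma>0 \<i> x) = x"
proof -
  have "x \<in> \<Gamma>0 ` eigenspace T \<i>" using assms \<Gamma>0_eigenspace by simp
  from the_inv_into_into[OF eigenspace_\<Gamma>0_inj this order_refl] f_the_inv_into_f[OF eigenspace_\<Gamma>0_inj this]
  show "gamma_field T \<Gamma>0 \<i> x \<in> Domain T" "app T (gamma_field T \<Gamma>0 \<i> x) = \<i> *\<^sub>C gamma_field T \<Gamma>0 \<i> x"
    "\<Gamma>0 (gamma_field T \<Gamma>0 \<i> x) = x"
    by (auto simp: gamma_field_def eigenspace_def)
qed

text \<open>Green's identity for \<open>u = (A0 + \<i>)\<^sup>-\<^sup>1 h\<close> and a solution of \<open>T g = \<i> g\<close>: the operator
  \<open>gamma_adj (- \<i>)\<close> is the adjoint of the gamma field.\<close>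

lemma gamma_adj_eq:
  assumes x: "x \<in> \<Gamma>0 ` Domain T"
  shows "cinner (gamma_adj (- \<i>) h) x = cinner h (gamma_field T \<Gamma>0 \<i> x)"
  using green_ker(1)[OF resolvent_ker[OF i_resolvent(2)] gamma_field(1)[OF x], of h]
  by (simp add: app_T_resolvent[OF i_resolvent(2)] gamma_field(2,3)[OF x] cinner_simps gamma_adj_def)

end


section \<open>The form norm of the imaginary part of the Weyl function\<close>

locale quasi_triple_norm = quasi_triple A T \<Gamma>0 \<Gamma>1
  for A T :: "('h::chilbert_space, 'h) graph" and \<Gamma>0 \<Gamma>1 :: "'h \<Rightarrow> 'g::chilbert_space" +
  fixes G1 :: "'g set" and N :: "'g \<Rightarrow> real"
  assumes G1: "G1 = \<Gamma>1 ` ker_on T \<Gamma>0" and G1_dense: "closure G1 = UNIV"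
    and G1_sub: "csubspace G1" and N: "is_norm_on G1 N" and N_complete: "complete_norm_on G1 N"
    and embedded: "norm_continuous_on G1 N norm (\<lambda>x. x)"
    and gamma_adj_cont: "\<exists>\<mu>\<in>resolvent_set A0. norm_continuous_on UNIV norm N (\<lambda>h. \<Gamma>1 (resolvent A0 (cnj \<mu>) h))"
begin

lemma gamma_adj_G1: "\<mu> \<in> resolvent_set A0 \<Longrightarrow> gamma_adj \<mu> h \<in> G1"
  using range_gamma_adj[of \<mu>] G1 by blast

text \<open>By the resolvent identity, \<open>gamma_adj \<nu>\<close> is \<open>gamma_adj \<mu>\<close> after a bounded operator on the
  Hilbert space, so that continuity at one point of the resolvent set propagates to all of it.\<close>

lemma gamma_adj_N_bound:
  assumes \<nu>: "\<nu> \<in> resolvent_set A0"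
  obtains c where "0 < c" "\<And>h. N (gamma_adj \<nu> h) \<le> c * norm h"
proof -
  obtain \<mu> where \<mu>: "\<mu> \<in> resolvent_set A0" "norm_continuous_on UNIV norm N (gamma_adj (cnj \<mu>))"
    using gamma_adj_cont unfolding gamma_adj_def by blast
  have \<mu>': "cnj \<mu> \<in> resolvent_set A0" by (rule resolvent_set_cnj[OF A0_self_adjoint \<mu>(1)])
  obtain c where c: "0 < c" "\<And>h. N (gamma_adj (cnj \<mu>) h) \<le> c * norm h"
    by (rule norm_continuous_on_imp_bounded[OF complex_vector.subspace_UNIV is_norm_on_norm N _ _ \<mu>(2)])
      (use gamma_adj_G1[OF \<mu>'] clinear_on_scaleC[OF clinear_gamma_adj[OF \<mu>']] in auto)
  obtain d where d: "0 < d" "\<And>h. norm (resolvent A0 \<nu> h) \<le> d * norm h"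
    using resolvent_bound[OF A0_linear \<nu>] by blast
  let ?e = "cmod (\<nu> - cnj \<mu>) * d"
  have "N (gamma_adj \<nu> h) \<le> (c * (1 + ?e)) * norm h" for h
  proof -
    have "N (gamma_adj \<nu> h) \<le> c * norm (h + (\<nu> - cnj \<mu>) *\<^sub>C resolvent A0 \<nu> h)"
      using c(2) gamma_adj_identity[OF \<mu>' \<nu>, of h] by simp
    also have "\<dots> \<le> c * (norm h + cmod (\<nu> - cnj \<mu>) * norm (resolvent A0 \<nu> h))"
      using c(1) norm_triangle_ineq[of h] by (intro mult_left_mono) (auto simp flip: norm_scaleC)
    also have "\<dots> \<le> c * (norm h + cmod (\<nu> - cnj \<mu>) * (d * norm h))"
      using c(1) d(2) by (intro mult_left_mono add_left_mono) auto
    finally show ?thesis by (simp add: algebra_simps)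
  qed
  moreover have "0 < c * (1 + ?e)" using c(1) d(1) by (intro mult_pos_pos add_pos_nonneg) auto
  ultimately show thesis using that by blast
qed

lemma gamma_adj_N_continuous:
  assumes "\<mu> \<in> resolvent_set A0"
  shows "norm_continuous_on UNIV norm N (\<lambda>h. \<Gamma>1 (resolvent A0 (cnj \<mu>) h))"
proof -
  have \<mu>: "cnj \<mu> \<in> resolvent_set A0" by (rule resolvent_set_cnj[OF A0_self_adjoint assms])
  obtain c where c: "0 < c" "\<And>h. N (gamma_adj (cnj \<mu>) h) \<le> c * norm h" using gamma_adj_N_bound[OF \<mu>] by blast
  then have "norm_continuous_on UNIV norm N (gamma_adj (cnj \<mu>))"
    using clinear_on_diff[OF complex_vector.subspace_UNIV clinear_gamma_adj[OF \<mu>]]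
    by (intro norm_continuous_on_if_bounded[of _ _ N c norm]) auto
  then show ?thesis by (simp add: gamma_adj_def[abs_def])
qed

lemma embedding_bound:
  obtains c where "0 < c" "\<And>y. y \<in> G1 \<Longrightarrow> norm y \<le> c * N y"
  by (rule norm_continuous_on_imp_bounded[OF G1_sub N is_norm_on_norm[of UNIV] _ _ embedded]) (use that in auto)

lemma bounded_linear_gamma_adj: "bounded_linear (gamma_adj (- \<i>))"
proof -
  obtain c where c: "0 < c" "\<And>y. y \<in> G1 \<Longrightarrow> norm y \<le> c * N y" using embedding_bound by blast
  obtain d where d: "0 < d" "\<And>h. N (gamma_adj (- \<i>) h) \<le> d * norm h" using gamma_adj_N_bound[OF i_resolvent(2)] by blast
  have "norm (gamma_adj (- \<i>) h) \<le> norm h * (c * d)" for h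
  proof -
    have "norm (gamma_adj (- \<i>) h) \<le> c * N (gamma_adj (- \<i>) h)" by (rule c(2)[OF gamma_adj_G1[OF i_resolvent(2)]])
    also have "\<dots> \<le> c * (d * norm h)" using c(1) d(2) by (intro mult_left_mono) auto
    finally show ?thesis by (simp add: mult_ac)
  qed
  then show ?thesis
    using clinear_gamma_adj[OF i_resolvent(2)]
    by (intro bounded_linear_intro) (auto simp: clinear_on_def scaleR_scaleC)
qed

lemma closure_gamma_field:
  obtains C where "adjoint_pair (gamma_adj (- \<i>)) C" "bounded_linear C"
    "\<And>x. x \<in> \<Gamma>0 ` Domain T \<Longrightarrow> gamma_field T \<Gamma>0 \<i> x = C x"
proof -
  obtain C where C: "adjoint_pair (gamma_adj (- \<i>)) C" "bounded_linear C"
    using adjoint_pair_exists[OF bounded_linear_gamma_adj clinear_gamma_adj[OF i_resolvent(2)]] by blast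
  moreover have "gamma_field T \<Gamma>0 \<i> x = C x" if "x \<in> \<Gamma>0 ` Domain T" for x
  proof (rule cinner_eqI)
    show "cinner (gamma_field T \<Gamma>0 \<i> x) h = cinner (C x) h" for h
      using gamma_adj_eq[OF that, of h] adjoint_pairD[OF C(1), of h x] by (metis cinner_commute)
  qed
  ultimately show thesis using that by blast
qed

text \<open>For \<open>x\<close>, \<open>z\<close> in the range of \<open>\<Gamma>0\<close>, Green's identity on the eigenspace at \<open>\<i>\<close> reads
  \<open>(M x, z) - (x, M z) = 2 \<i> (C x, C z)\<close>, where \<open>C\<close> extends the gamma field. As the range of
  \<open>\<Gamma>0\<close> is dense, this determines the adjoint of \<open>M\<close> on it, and the imaginary part is the
  restriction of \<open>x \<mapsto> gamma_adj (- \<i>) (C x)\<close>, the extended gamma field followed by its adjoint.\<close>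

lemma Lambda_op_eq:
  assumes pair: "adjoint_pair (gamma_adj (- \<i>)) C" and C: "bounded_linear C"
    and gamma: "\<And>x. x \<in> \<Gamma>0 ` Domain T \<Longrightarrow> gamma_field T \<Gamma>0 \<i> x = C x"
  shows "Lambda_op T \<Gamma>0 \<Gamma>1 = graph_of (\<lambda>x. gamma_adj (- \<i>) (C x))"
proof -
  let ?D = "\<Gamma>0 ` Domain T"
  let ?M = "weyl_function T \<Gamma>0 \<Gamma>1 \<i>"
  have M: "?M = {(x, \<Gamma>1 (C x)) | x. x \<in> ?D}"
    unfolding weyl_function_def by (intro Collect_cong ex_cong1) (metis gamma)
  have adj: "cinner (\<Gamma>1 (C z)) x = cinner z (\<Gamma>1 (C x) - (2 * \<i>) *\<^sub>C gamma_adj (- \<i>) (C x))"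
    if x: "x \<in> ?D" and z: "z \<in> ?D" for x z
  proof -
    note gx = gamma_field[OF x, unfolded gamma[OF x]] and gz = gamma_field[OF z, unfolded gamma[OF z]]
    have "2 * \<i> * cinner (C z) (C x) = cinner (\<Gamma>1 (C z)) x - cinner z (\<Gamma>1 (C x))"
      using green[OF gz(1) gx(1)] by (simp add: gx(2,3) gz(2,3) cinner_simps mult.assoc)
    then show ?thesis by (simp add: cinner_simps adjoint_pairD'[OF pair])
  qed
  have adj_iff: "(x, y') \<in> adjoint_op ?M \<longleftrightarrow> y' = \<Gamma>1 (C x) - (2 * \<i>) *\<^sub>C gamma_adj (- \<i>) (C x)" if x: "x \<in> ?D" for x y'
  proof
    assume "(x, y') \<in> adjoint_op ?M"
    then have eq: "cinner z y' = cinner z (\<Gamma>1 (C x) - (2 * \<i>) *\<^sub>C gamma_adj (- \<i>) (C x))" if "z \<in> ?D" for z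
      using adj[OF x that] that unfolding adjoint_op_def M by auto
    have "cinner (y' - (\<Gamma>1 (C x) - (2 * \<i>) *\<^sub>C gamma_adj (- \<i>) (C x))) z = 0" if "z \<in> ?D" for z
    proof -
      have "cinner z (y' - (\<Gamma>1 (C x) - (2 * \<i>) *\<^sub>C gamma_adj (- \<i>) (C x))) = 0"
        using eq[OF that] by (simp add: cinner_diff_right)
      then show ?thesis by (subst cinner_commute) simp
    qed
    from orthogonal_dense_imp_zero[OF range_\<Gamma>0_dense this]
    show "y' = \<Gamma>1 (C x) - (2 * \<i>) *\<^sub>C gamma_adj (- \<i>) (C x)" by simp
  next
    assume "y' = \<Gamma>1 (C x) - (2 * \<i>) *\<^sub>C gamma_adj (- \<i>) (C x)"
    then show "(x, y') \<in> adjoint_op ?M" using adj[OF x] by (auto simp: adjoint_op_def M)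
  qed
  have M_iff: "(x, y) \<in> ?M \<longleftrightarrow> x \<in> ?D \<and> y = \<Gamma>1 (C x)" for x y unfolding M by blast
  have half: "(1 / (2 * \<i>)) *\<^sub>C (a - (a - (2 * \<i>) *\<^sub>C k)) = k" for a k :: 'g
    by (simp add: scaleC_one)
  have "imag_part_op ?M = (\<lambda>x. (x, gamma_adj (- \<i>) (C x))) ` ?D"
  proof (intro antisym subsetI)
    fix p assume "p \<in> imag_part_op ?M"
    then obtain x y y' where p: "p = (x, (1 / (2 * \<i>)) *\<^sub>C (y - y'))" "(x, y) \<in> ?M" "(x, y') \<in> adjoint_op ?M"
      unfolding imag_part_op_def by blast
    then have "x \<in> ?D" "p = (x, gamma_adj (- \<i>) (C x))" using M_iff[of x y] adj_iff[of x y'] half by auto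
    then show "p \<in> (\<lambda>x. (x, gamma_adj (- \<i>) (C x))) ` ?D" by blast
  next
    fix p assume "p \<in> (\<lambda>x. (x, gamma_adj (- \<i>) (C x))) ` ?D"
    then obtain x where x: "x \<in> ?D" and p: "p = (x, gamma_adj (- \<i>) (C x))" by blast
    have "(x, (1 / (2 * \<i>)) *\<^sub>C (\<Gamma>1 (C x) - (\<Gamma>1 (C x) - (2 * \<i>) *\<^sub>C gamma_adj (- \<i>) (C x)))) \<in> imag_part_op ?M"
      using M_iff[of x] adj_iff[OF x] x unfolding imag_part_op_def by blast
    then show "p \<in> imag_part_op ?M" unfolding half p .
  qed
  then show ?thesis
    using closure_restricted_graph[OF bounded_linear_compose[OF bounded_linear_gamma_adj C] range_\<Gamma>0_dense]
    by (simp add: Lambda_op_def)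
qed

text \<open>\<open>G1\<close> is the range both of \<open>gamma_adj (- \<i>)\<close> and of the square root \<open>S\<close> of \<open>\<Lambda>\<close>: if \<open>C\<close> is the
  closure of the gamma field, then \<open>norm (S x) = norm (C x)\<close>, and Douglas' lemma applies. It also
  supplies a preimage \<open>h\<close> of \<open>S x\<close> under \<open>gamma_adj (- \<i>)\<close> with \<open>norm h \<le> norm x\<close>, which bounds \<open>N\<close> by
  the form norm, since the form norm of \<open>S x\<close> is \<open>norm x\<close>. Conversely, the form norm of \<open>y\<close> is the
  supremum of \<open>cmod (y, u)\<close> over all \<open>u\<close> with \<open>norm (S u) \<le> 1\<close>. These functionals are continuous for
  \<open>N\<close> and pointwise bounded, hence uniformly bounded.\<close>

theorem Lambda_norm_equivalent:
  "equivalent_norms_on G1 N (induced_norm (Lambda_inner T \<Gamma>0 \<Gamma>1))"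
proof -
  obtain C where pair: "adjoint_pair (gamma_adj (- \<i>)) C" and C: "bounded_linear C"
    and gamma: "\<And>x. x \<in> \<Gamma>0 ` Domain T \<Longrightarrow> gamma_field T \<Gamma>0 \<i> x = C x"
    using closure_gamma_field by blast
  define L where "L x = gamma_adj (- \<i>) (C x)" for x
  have "positive_map L"
    unfolding positive_map_def
  proof (intro conjI allI)
    show "bounded_linear L"
      using bounded_linear_compose[OF bounded_linear_gamma_adj C] by (simp add: L_def[abs_def])
    show "cinner (L x) y = cinner x (L y)" "0 \<le> Re (cinner (L x) x)" for x y
      by (simp_all add: L_def adjoint_pairD[OF pair] adjoint_pairD'[OF pair] Re_cinner_self)
  qed
  then obtain S where S: "positive_map S" "\<And>x. S (S x) = L x" "sqrt_op (graph_of L) = graph_of S"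
    using sqrt_op_graph_of by blast
  have sqrt_Lambda: "sqrt_op (Lambda_op T \<Gamma>0 \<Gamma>1) = graph_of S"
    using Lambda_op_eq[OF pair C gamma] S(3) by (simp add: L_def[abs_def])
  interpret S: bounded_linear S using S(1) by (rule positive_map_linear)
  have S_pair: "adjoint_pair S S" by (simp add: adjoint_pair_def positive_map_sym[OF S(1)])
  have norm_S: "norm (S x) = norm (C x)" for x
  proof -
    have "complex_of_real ((norm (S x))\<^sup>2) = of_real ((norm (C x))\<^sup>2)"
      unfolding cinner_self_eq_norm[symmetric]
      by (simp add: positive_map_sym[OF S(1)] S(2) L_def adjoint_pairD'[OF pair])
    then have "(norm (S x))\<^sup>2 = (norm (C x))\<^sup>2" using of_real_eq_iff by blast
    then show ?thesis by simp
  qed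
  have range_S: "range S = G1"
  proof -
    have "S x \<in> range (gamma_adj (- \<i>))" for x
      by (rule douglas_range_inclusion[OF S_pair pair, of x]) (auto simp: norm_S)
    moreover have "gamma_adj (- \<i>) h \<in> range S" for h
      by (rule douglas_range_inclusion[OF pair S_pair, of h]) (auto simp: norm_S)
    ultimately have "range S = range (gamma_adj (- \<i>))" by blast
    then show ?thesis using range_gamma_adj[OF i_resolvent(2)] G1 by simp
  qed
  have S_inj: "x = y" if "S x = S y" for x y
  proof -
    have "cinner (x - y) (S v) = 0" for v
      using that by (simp add: positive_map_sym[OF S(1), symmetric] S.diff)
    then have "x - y = 0" using range_S by (intro orthogonal_dense_imp_zero[OF G1_dense]) auto
    then show ?thesis by simp
  qed
  have "app ((graph_of S)\<inverse>) (S x) = x" for x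
    by (rule app_eq) (auto simp: single_valued_def S_inj)
  then have form_norm: "induced_norm (Lambda_inner T \<Gamma>0 \<Gamma>1) (S x) = norm x" for x
    by (simp add: induced_norm_def Lambda_inner_def sqrt_Lambda Re_cinner_self)
  obtain c where c: "0 < c" "\<And>h. N (gamma_adj (- \<i>) h) \<le> c * norm h" using gamma_adj_N_bound[OF i_resolvent(2)] by blast
  have lower: "N (S x) \<le> c * norm x" for x
  proof -
    obtain h where h: "S x = gamma_adj (- \<i>) h" "norm h \<le> norm x"
      by (rule douglas_range_inclusion[OF S_pair pair, of x]) (auto simp: norm_S)
    have "N (S x) \<le> c * norm h" using c(2) h(1) by simp
    also have "\<dots> \<le> c * norm x" using c(1) h(2) by simp
    finally show ?thesis .
  qed
  define P where "P = {\<lambda>y. cmod (cinner y u) | u. norm (S u) \<le> 1}"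
  obtain e where e: "0 < e" "\<And>y. y \<in> G1 \<Longrightarrow> norm y \<le> e * N y" using embedding_bound by blast
  have bounded: "\<exists>d. \<forall>y\<in>G1. cmod (cinner y u) \<le> d * N y" for u
  proof (intro exI ballI)
    fix y assume "y \<in> G1"
    have "cmod (cinner y u) \<le> norm y * norm u" by (rule Cauchy_Schwarz_cinner)
    also have "\<dots> \<le> (e * N y) * norm u" by (intro mult_right_mono e \<open>y \<in> G1\<close>) simp
    finally show "cmod (cinner y u) \<le> (e * norm u) * N y" by (simp add: mult_ac)
  qed
  have each: "\<exists>d. \<forall>y\<in>G1. p y \<le> d * N y" if "p \<in> P" for p
    using that bounded by (auto simp: P_def)
  have pointwise: "\<exists>d. \<forall>p\<in>P. p y \<le> d" if "y \<in> G1" for y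
  proof -
    obtain x where x: "y = S x" using \<open>y \<in> G1\<close> range_S by blast
    have "cmod (cinner y u) \<le> norm x" if "norm (S u) \<le> 1" for u
    proof -
      have "cmod (cinner y u) \<le> norm x * norm (S u)"
        using Cauchy_Schwarz_cinner[of x "S u"] by (simp add: x positive_map_sym[OF S(1)])
      also have "\<dots> \<le> norm x * 1" by (intro mult_left_mono that) simp
      finally show ?thesis by simp
    qed
    then show ?thesis by (auto simp: P_def)
  qed
  have seminorm: "p (x + y) \<le> p x + p y" "p (a *\<^sub>C x) = cmod a * p x" if "p \<in> P" for p a x y
    using that by (auto simp: P_def cinner_simps norm_mult norm_triangle_ineq)
  obtain d where d: "0 < d" "\<And>p y. p \<in> P \<Longrightarrow> y \<in> G1 \<Longrightarrow> p y \<le> d * N y"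
    by (rule uniform_boundedness[OF G1_sub N N_complete seminorm each pointwise]) (assumption+, rule that)
  have upper: "norm x \<le> d * N (S x)" for x
  proof (rule norm_le_dense)
    have Sx: "S x \<in> G1" using range_S by blast
    show "0 \<le> d * N (S x)" using d(1) is_norm_on_nonneg[OF N Sx] by simp
    show "closure (range S) = UNIV" using range_S G1_dense by simp
    fix v assume "v \<in> range S"
    then obtain u where u: "v = S u" by blast
    show "cmod (cinner x v) \<le> d * N (S x) * norm v"
    proof (cases "norm v = 0")
      case False
      define w where "w = (1 / norm v) *\<^sub>R u"
      have "norm (S w) = 1" using False u by (simp add: w_def S.scaleR)
      then have "(\<lambda>y. cmod (cinner y w)) \<in> P" by (auto simp: P_def)
      from d(2)[OF this Sx] have "cmod (cinner (S x) w) \<le> d * N (S x)" .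
      moreover have "cmod (cinner (S x) w) = cmod (cinner x v) / norm v"
        by (simp add: positive_map_sym[OF S(1)] w_def S.scaleR cinner_simps u norm_divide)
      ultimately show ?thesis using False by (simp add: field_simps)
    qed simp
  qed
  show ?thesis
    unfolding equivalent_norms_on_def
  proof (intro exI conjI ballI)
    show "0 < 1 / c" "0 < d" using c(1) d(1) by auto
    fix y assume "y \<in> G1"
    then obtain x where x: "y = S x" using range_S by blast
    show "1 / c * N y \<le> induced_norm (Lambda_inner T \<Gamma>0 \<Gamma>1) y"
      using lower[of x] c(1) by (simp add: x form_norm field_simps)
    show "induced_norm (Lambda_inner T \<Gamma>0 \<Gamma>1) y \<le> d * N y"
      using upper[of x] by (simp add: x form_norm)
  qed
qed

end

section \<open>The extension of the boundary map\<close>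

lemma antilinear_on_add: "antilinear_on V \<phi> \<Longrightarrow> x \<in> V \<Longrightarrow> y \<in> V \<Longrightarrow> \<phi> (x + y) = \<phi> x + \<phi> y"
  and antilinear_on_scaleC: "antilinear_on V \<phi> \<Longrightarrow> x \<in> V \<Longrightarrow> \<phi> (a *\<^sub>C x) = cnj a *\<^sub>C \<phi> x"
  by (auto simp: antilinear_on_def)

lemma antilinear_on_diff:
  "csubspace V \<Longrightarrow> antilinear_on V \<phi> \<Longrightarrow> x \<in> V \<Longrightarrow> y \<in> V \<Longrightarrow> \<phi> (x - y) = \<phi> x - \<phi> y"
  using antilinear_on_add[of V \<phi> "x - y" y] by (simp add: complex_vector.subspace_diff)

lemma antidual_bounded:
  assumes V: "csubspace V" "is_norm_on V n" and \<phi>: "\<phi> \<in> antidual V n"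
  obtains c where "0 < c" "\<And>x. x \<in> V \<Longrightarrow> cmod (\<phi> x) \<le> c * n x"
proof -
  have "norm_continuous_on V n cmod \<phi>" and lin: "antilinear_on V \<phi>"
    using \<phi> by (auto simp: antidual_def)
  from norm_continuous_on_imp_bounded[OF V is_norm_on_norm[of UNIV] _ _ this(1)] show thesis
    using that antilinear_on_scaleC[OF lin] by auto
qed

lemma antidual_diff:
  assumes V: "csubspace V" "is_norm_on V n" and \<phi>: "\<phi> \<in> antidual V n" and \<psi>: "\<psi> \<in> antidual V n"
  shows "\<phi> - \<psi> \<in> antidual V n"
proof -
  obtain c where c: "0 < c" "\<And>x. x \<in> V \<Longrightarrow> cmod (\<phi> x) \<le> c * n x" by (rule antidual_bounded[OF V \<phi>]) (rule that)
  obtain d where d: "0 < d" "\<And>x. x \<in> V \<Longrightarrow> cmod (\<psi> x) \<le> d * n x" by (rule antidual_bounded[OF V \<psi>]) (rule that)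
  have lin: "antilinear_on V \<phi>" "antilinear_on V \<psi>" using \<phi> \<psi> by (auto simp: antidual_def)
  then have "antilinear_on V (\<phi> - \<psi>)"
    by (auto simp: antilinear_on_def scaleC_complex_def algebra_simps)
  moreover have "norm_continuous_on V n cmod (\<phi> - \<psi>)"
  proof (rule norm_continuous_on_if_bounded[OF V(1)])
    show "(\<phi> - \<psi>) (x - y) = (\<phi> - \<psi>) x - (\<phi> - \<psi>) y" if "x \<in> V" "y \<in> V" for x y
      using antilinear_on_diff[OF V(1) lin(1) that] antilinear_on_diff[OF V(1) lin(2) that]
      by (simp add: algebra_simps)
    show "cmod ((\<phi> - \<psi>) x) \<le> (c + d) * n x" if "x \<in> V" for x
      using c(2)[OF that] d(2)[OF that] norm_triangle_ineq4[of "\<phi> x" "\<psi> x"] by (simp add: distrib_right)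
    show "0 \<le> c + d" using c(1) d(1) by simp
  qed
  ultimately show ?thesis using \<phi> \<psi> by (simp add: antidual_def)
qed

text \<open>The supremum in the definition of the functional norm is finite because elements of the
  anti-dual are bounded; homogeneity then extends the estimate from the unit ball to all of
  \<open>V\<close>.\<close>

lemma functional_norm_bound:
  assumes V: "csubspace V" "is_norm_on V n" and \<phi>: "\<phi> \<in> antidual V n" and x: "x \<in> V"
  shows "cmod (\<phi> x) \<le> functional_norm V n \<phi> * n x"
proof (cases "n x = 0")
  case True
  then have "x = 0" using is_norm_on_eq_0[OF V(2) x] by simp
  then show ?thesis using antilinear_on_scaleC[of V \<phi> x 0] \<phi> x True by (simp add: antidual_def)
next
  case False
  then have nx: "n x > 0" using is_norm_on_nonneg[OF V(2) x] by simp
  obtain c where c: "0 < c" "\<And>x. x \<in> V \<Longrightarrow> cmod (\<phi> x) \<le> c * n x" by (rule antidual_bounded[OF V \<phi>]) (rule that)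
  have "cmod (\<phi> z) \<le> c" if "z \<in> V" "n z \<le> 1" for z
    using c(2)[OF that(1)] mult_left_mono[OF that(2), of c] c(1) by linarith
  then have bdd: "bdd_above ((\<lambda>x. cmod (\<phi> x)) ` {x \<in> V. n x \<le> 1})" by (intro bdd_aboveI[of _ c]) auto
  define z where "z = complex_of_real (1 / n x) *\<^sub>C x"
  have "z \<in> V" "n z \<le> 1"
    using is_norm_on_scaleC[OF V(2) x, of "of_real (1 / n x)"] nx x
    by (auto simp: z_def complex_vector.subspace_scale[OF V(1)] norm_divide)
  then have "cmod (\<phi> z) \<le> functional_norm V n \<phi>"
    unfolding functional_norm_def by (intro cSUP_upper bdd) auto
  moreover have "cmod (\<phi> z) = cmod (\<phi> x) / n x"
    using antilinear_on_scaleC[of V \<phi> x "of_real (1 / n x)"] \<phi> x nx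
    by (simp add: z_def antidual_def scaleC_complex_def norm_mult norm_divide)
  ultimately show ?thesis using nx by (simp add: field_simps)
qed

lemma functional_norm_le:
  assumes V: "csubspace V" "is_norm_on V n" and "0 \<le> c" and "\<And>x. x \<in> V \<Longrightarrow> cmod (\<phi> x) \<le> c * n x"
  shows "functional_norm V n \<phi> \<le> c"
  unfolding functional_norm_def
proof (rule cSUP_least)
  have "n 0 = 0"
    using is_norm_on_scaleC[OF V(2) complex_vector.subspace_0[OF V(1)], of 0] by simp
  then show "{x \<in> V. n x \<le> 1} \<noteq> {}" using complex_vector.subspace_0[OF V(1)] by force
  fix x assume x: "x \<in> {x \<in> V. n x \<le> 1}"
  then have "cmod (\<phi> x) \<le> c * n x" using assms(4) by blast
  also have "\<dots> \<le> c * 1" using x assms(3) by (intro mult_left_mono) auto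
  finally show "cmod (\<phi> x) \<le> c" by simp
qed

lemma graph_norm_app: "graph_norm S f = norm (f, app S f)"
  by (simp add: graph_norm_def norm_Pair)

context quasi_triple
begin

lemma Domain_T_graph_dense:
  assumes "f \<in> Domain As"
  obtains g where "\<And>n. g n \<in> Domain T" "g \<longlonglongrightarrow> f" "(\<lambda>n. app T (g n)) \<longlonglongrightarrow> app As f"
proof -
  have "(f, app As f) \<in> closure T" using As_app[OF assms] closure_T by simp
  then obtain p where p: "\<And>n. p n \<in> T" "p \<longlonglongrightarrow> (f, app As f)" using closure_sequential by blast
  have mem: "(fst (p n), snd (p n)) \<in> T" for n using p(1) by simp
  have "app T (fst (p n)) = snd (p n)" for n by (rule app_eq[OF single_valued_T mem])
  moreover have "fst (p n) \<in> Domain T" for n using mem by blast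
  ultimately show thesis
    using that[of "\<lambda>n. fst (p n)"] tendsto_fst[OF p(2)] tendsto_snd[OF p(2)] by simp
qed

text \<open>The right-hand side of Green's identity for \<open>f\<close> in the domain of \<open>A\<^sup>*\<close> and \<open>u\<close> in the kernel of
  \<open>\<Gamma>0\<close>. On the domain of \<open>T\<close> it equals \<open>(\<Gamma>0 f, \<Gamma>1 u)\<close>, and both sides extend by density of
  \<open>T\<close> in \<open>A\<^sup>*\<close>; in particular it depends on \<open>u\<close> only through \<open>\<Gamma>1 u\<close>.\<close>

definition bform :: "'h \<Rightarrow> 'h \<Rightarrow> complex" where
  "bform f u = cinner f (app T u) - cinner (app As f) u"

lemma bform_T: "f \<in> Domain T \<Longrightarrow> u \<in> ker_on T \<Gamma>0 \<Longrightarrow> bform f u = cinner (\<Gamma>0 f) (\<Gamma>1 u)"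
  using green_ker(2)[of u f] by (simp add: bform_def app_As_T)

lemma bform_limit:
  assumes f: "f \<in> Domain As"
  obtains g where "\<And>n. g n \<in> Domain T" "(\<lambda>n. norm (g n, app T (g n))) \<longlonglongrightarrow> graph_norm As f"
    "\<And>u. u \<in> ker_on T \<Gamma>0 \<Longrightarrow> (\<lambda>n. cinner (\<Gamma>0 (g n)) (\<Gamma>1 u)) \<longlonglongrightarrow> bform f u"
proof -
  obtain g where g: "\<And>n. g n \<in> Domain T" "g \<longlonglongrightarrow> f" "(\<lambda>n. app T (g n)) \<longlonglongrightarrow> app As f"
    by (rule Domain_T_graph_dense[OF f]) (rule that)
  have lim: "(\<lambda>n. cinner (\<Gamma>0 (g n)) (\<Gamma>1 u)) \<longlonglongrightarrow> bform f u" if u: "u \<in> ker_on T \<Gamma>0" for u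
  proof -
    have "(\<lambda>n. cinner (g n) (app T u) - cinner (app T (g n)) u) \<longlonglongrightarrow> bform f u"
      unfolding bform_def by (intro tendsto_intros g)
    then show ?thesis using green_ker(2)[OF u g(1)] by simp
  qed
  have "(\<lambda>n. norm (g n, app T (g n))) \<longlonglongrightarrow> graph_norm As f"
    unfolding graph_norm_app by (intro tendsto_intros g)
  from g(1) this lim show thesis by (rule that)
qed

lemma bform_cong:
  assumes f: "f \<in> Domain As" and u: "u \<in> ker_on T \<Gamma>0" and v: "v \<in> ker_on T \<Gamma>0" and eq: "\<Gamma>1 u = \<Gamma>1 v"
  shows "bform f u = bform f v"
proof -
  obtain g where "\<And>u. u \<in> ker_on T \<Gamma>0 \<Longrightarrow> (\<lambda>n. cinner (\<Gamma>0 (g n)) (\<Gamma>1 u)) \<longlonglongrightarrow> bform f u"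
    by (rule bform_limit[OF f]) (rule that)
  from this[OF u] this[OF v] show ?thesis using eq LIMSEQ_unique by fastforce
qed

definition extension :: "'h \<Rightarrow> 'g \<Rightarrow> complex" where
  "extension f y = (if y \<in> \<Gamma>1 ` ker_on T \<Gamma>0 then bform f (SOME u. u \<in> ker_on T \<Gamma>0 \<and> \<Gamma>1 u = y) else 0)"

lemma ext_\<Gamma>1:
  assumes f: "f \<in> Domain As" and u: "u \<in> ker_on T \<Gamma>0"
  shows "extension f (\<Gamma>1 u) = bform f u"
proof -
  define v where "v = (SOME v. v \<in> ker_on T \<Gamma>0 \<and> \<Gamma>1 v = \<Gamma>1 u)"
  have "\<exists>v. v \<in> ker_on T \<Gamma>0 \<and> \<Gamma>1 v = \<Gamma>1 u" using u by blast
  from someI_ex[OF this] have v: "v \<in> ker_on T \<Gamma>0" "\<Gamma>1 v = \<Gamma>1 u" by (simp_all add: v_def)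
  have "extension f (\<Gamma>1 u) = bform f v" using u by (simp add: extension_def v_def)
  then show ?thesis using bform_cong[OF f v(1) u v(2)] by simp
qed

lemma app_As_add: "f \<in> Domain As \<Longrightarrow> g \<in> Domain As \<Longrightarrow> app As (f + g) = app As f + app As g"
  and app_As_scaleC: "f \<in> Domain As \<Longrightarrow> app As (a *\<^sub>C f) = a *\<^sub>C app As f"
  using clinear_on_app[OF linear_As] by (auto simp: clinear_on_def)

lemma Domain_As: "csubspace (Domain As)" by (rule linear_operator_Domain[OF linear_As])

lemma clinear_ext: "clinear_on (Domain As) extension"
proof -
  have "extension (f + g) y = extension f y + extension g y" if "f \<in> Domain As" "g \<in> Domain As" for f g y
    using that by (simp add: extension_def bform_def app_As_add cinner_simps)
  moreover have "extension (a *\<^sub>C f) y = a *\<^sub>C extension f y" if "f \<in> Domain As" for a f y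
    using that by (simp add: extension_def bform_def app_As_scaleC cinner_simps scaleC_complex_def algebra_simps)
  ultimately show ?thesis by (simp add: clinear_on_def fun_eq_iff scaleC_fun_def)
qed

lemma ext_antilinear:
  assumes f: "f \<in> Domain As"
  shows "antilinear_on (\<Gamma>1 ` ker_on T \<Gamma>0) (extension f)"
  unfolding antilinear_on_def
proof (intro conjI ballI allI; elim imageE)
  fix x y u v assume u: "x = \<Gamma>1 u" "u \<in> ker_on T \<Gamma>0" and v: "y = \<Gamma>1 v" "v \<in> ker_on T \<Gamma>0"
  have uv: "u + v \<in> ker_on T \<Gamma>0" by (rule complex_vector.subspace_add[OF csubspace_ker u(2) v(2)])
  have "\<Gamma>1 (u + v) = x + y"
    using clinear_on_add[OF clinear_\<Gamma>1 kerD(1)[OF u(2)] kerD(1)[OF v(2)]] u v by simp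
  moreover have "bform f (u + v) = bform f u + bform f v"
    using clinear_on_add[OF clinear_on_app[OF linear_T] kerD(1)[OF u(2)] kerD(1)[OF v(2)]]
    by (simp add: bform_def cinner_simps)
  ultimately show "extension f (x + y) = extension f x + extension f y"
    using ext_\<Gamma>1[OF f uv] ext_\<Gamma>1[OF f u(2)] ext_\<Gamma>1[OF f v(2)] u(1) v(1) by simp
next
  fix a x u assume u: "x = \<Gamma>1 u" "u \<in> ker_on T \<Gamma>0"
  have au: "a *\<^sub>C u \<in> ker_on T \<Gamma>0" by (rule complex_vector.subspace_scale[OF csubspace_ker u(2)])
  have "\<Gamma>1 (a *\<^sub>C u) = a *\<^sub>C x"
    using clinear_on_scaleC[OF clinear_\<Gamma>1 kerD(1)[OF u(2)]] u by simp
  moreover have "bform f (a *\<^sub>C u) = cnj a * bform f u"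
    using clinear_on_scaleC[OF clinear_on_app[OF linear_T] kerD(1)[OF u(2)]]
    by (simp add: bform_def cinner_simps algebra_simps)
  ultimately show "extension f (a *\<^sub>C x) = cnj a *\<^sub>C extension f x"
    using ext_\<Gamma>1[OF f au] ext_\<Gamma>1[OF f u(2)] u(1) by (simp add: scaleC_complex_def)
qed

end

context quasi_triple_norm
begin

text \<open>Uniform boundedness on \<open>(G1, N)\<close> for the functionals \<open>(\<Gamma>0 f, \<cdot>)\<close> with \<open>f\<close> in the graph
  norm unit ball of the domain of \<open>T\<close>: each is continuous since \<open>G1\<close> is continuously embedded, and at
  \<open>\<Gamma>1 u\<close> all of them are bounded by \<open>norm (T u) + norm u\<close>. The estimate survives the passage to
  the graph closure.\<close>

lemma ext_bound:
  obtains C where "0 < C" "\<And>f y. f \<in> Domain As \<Longrightarrow> y \<in> G1 \<Longrightarrow> cmod (extension f y) \<le> C * graph_norm As f * N y"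
proof -
  define P where "P = {\<lambda>y. cmod (cinner (\<Gamma>0 f) y) | f. f \<in> Domain T \<and> norm (f, app T f) \<le> 1}"
  obtain e where e: "0 < e" "\<And>y. y \<in> G1 \<Longrightarrow> norm y \<le> e * N y" using embedding_bound by blast
  have each: "\<exists>c. \<forall>y\<in>G1. p y \<le> c * N y" if p: "p \<in> P" for p
  proof -
    obtain f where f: "p = (\<lambda>y. cmod (cinner (\<Gamma>0 f) y))" using p by (auto simp: P_def)
    have "p y \<le> (norm (\<Gamma>0 f) * e) * N y" if y: "y \<in> G1" for y
    proof -
      have "p y \<le> norm (\<Gamma>0 f) * norm y" by (simp add: f Cauchy_Schwarz_cinner)
      also have "\<dots> \<le> norm (\<Gamma>0 f) * (e * N y)" by (intro mult_left_mono e y) simp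
      finally show ?thesis by (simp add: mult_ac)
    qed
    then show ?thesis by blast
  qed
  have pointwise: "\<exists>c. \<forall>p\<in>P. p y \<le> c" if y: "y \<in> G1" for y
  proof -
    obtain u where u: "u \<in> ker_on T \<Gamma>0" "y = \<Gamma>1 u" using y G1 by blast
    have "cmod (cinner (\<Gamma>0 f) y) \<le> norm (app T u) + norm u"
      if f: "f \<in> Domain T" "norm (f, app T f) \<le> 1" for f
    proof -
      have le: "norm f \<le> 1" "norm (app T f) \<le> 1"
        using f(2) norm_fst_le[of f "app T f"] norm_snd_le[of "app T f" f] by linarith+
      have "cmod (cinner (\<Gamma>0 f) y) = cmod (cinner f (app T u) - cinner (app T f) u)"
        using green_ker(2)[OF u(1) f(1)] u(2) by simp
      also have "\<dots> \<le> norm f * norm (app T u) + norm (app T f) * norm u"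
        by (intro order_trans[OF norm_triangle_ineq4] add_mono Cauchy_Schwarz_cinner)
      also have "\<dots> \<le> 1 * norm (app T u) + 1 * norm u" by (intro add_mono mult_right_mono le) auto
      finally show ?thesis by simp
    qed
    then show ?thesis by (auto simp: P_def)
  qed
  have seminorm: "p (x + y) \<le> p x + p y" "p (a *\<^sub>C x) = cmod a * p x" if "p \<in> P" for p a x y
    using that by (auto simp: P_def cinner_simps norm_mult norm_triangle_ineq)
  obtain C where C: "0 < C" "\<And>p y. p \<in> P \<Longrightarrow> y \<in> G1 \<Longrightarrow> p y \<le> C * N y"
    by (rule uniform_boundedness[OF G1_sub N N_complete seminorm each pointwise]) (assumption+, rule that)
  have on_T: "cmod (cinner (\<Gamma>0 f) y) \<le> C * norm (f, app T f) * N y" if f: "f \<in> Domain T" and y: "y \<in> G1" for f y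
  proof (cases "norm (f, app T f) = 0")
    case True
    then have "f = 0" by (simp add: zero_prod_def)
    then have "\<Gamma>0 f = 0" using clinear_on_scaleC[OF clinear_\<Gamma>0 f, of 0] by simp
    then show ?thesis using True by simp
  next
    case False
    define r where "r = norm (f, app T f)"
    have r: "r > 0" using False by (simp add: r_def)
    define g where "g = complex_of_real (1 / r) *\<^sub>C f"
    have g: "g \<in> Domain T" unfolding g_def by (rule complex_vector.subspace_scale[OF Domain_T f])
    have "(g, app T g) = (1 / r) *\<^sub>R (f, app T f)"
      unfolding g_def clinear_on_scaleC[OF clinear_on_app[OF linear_T] f]
      by (simp add: scaleR_scaleC)
    then have "norm (g, app T g) = (1 / r) * norm (f, app T f)"
      using r by (simp only: norm_scaleR) simp
    then have "norm (g, app T g) = 1" using r by (simp add: r_def)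
    then have "(\<lambda>y. cmod (cinner (\<Gamma>0 g) y)) \<in> P" using g by (auto simp: P_def)
    from C(2)[OF this y] have "cmod (cinner (\<Gamma>0 g) y) \<le> C * N y" .
    moreover have "cmod (cinner (\<Gamma>0 g) y) = cmod (cinner (\<Gamma>0 f) y) / r"
      using r unfolding g_def clinear_on_scaleC[OF clinear_\<Gamma>0 f]
      by (simp add: cinner_simps norm_mult norm_divide)
    ultimately show ?thesis using r by (simp add: r_def[symmetric] field_simps)
  qed
  have "cmod (extension f y) \<le> C * graph_norm As f * N y" if f: "f \<in> Domain As" and y: "y \<in> G1" for f y
  proof -
    obtain u where u: "u \<in> ker_on T \<Gamma>0" "y = \<Gamma>1 u" using y G1 by blast
    obtain g where g: "\<And>n. g n \<in> Domain T" "(\<lambda>n. norm (g n, app T (g n))) \<longlonglongrightarrow> graph_norm As f"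
      "\<And>u. u \<in> ker_on T \<Gamma>0 \<Longrightarrow> (\<lambda>n. cinner (\<Gamma>0 (g n)) (\<Gamma>1 u)) \<longlonglongrightarrow> bform f u"
      by (rule bform_limit[OF f]) (rule that)
    have "(\<lambda>n. cmod (cinner (\<Gamma>0 (g n)) y)) \<longlonglongrightarrow> cmod (extension f y)"
      unfolding u(2) ext_\<Gamma>1[OF f u(1)] by (intro tendsto_intros g(3) u)
    moreover have "(\<lambda>n. C * norm (g n, app T (g n)) * N y) \<longlonglongrightarrow> C * graph_norm As f * N y"
      by (intro tendsto_intros g(2))
    ultimately show ?thesis using on_T[OF g(1) y] by (blast intro: LIMSEQ_le)
  qed
  with C(1) show thesis by (rule that)
qed

lemma graph_norm_nonneg: "0 \<le> graph_norm S f"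
  for S :: "('x::real_normed_vector, 'y::real_normed_vector) graph"
  by (simp add: graph_norm_def)

lemma ext_antidual:
  assumes f: "f \<in> Domain As"
  shows "extension f \<in> antidual G1 N"
proof -
  obtain C where C: "0 < C" "\<And>f y. f \<in> Domain As \<Longrightarrow> y \<in> G1 \<Longrightarrow> cmod (extension f y) \<le> C * graph_norm As f * N y"
    by (rule ext_bound) (rule that)
  have lin: "antilinear_on G1 (extension f)" using ext_antilinear[OF f] G1 by simp
  have "norm_continuous_on G1 N cmod (extension f)"
    using antilinear_on_diff[OF G1_sub lin] C(2)[OF f] C(1)
    by (intro norm_continuous_on_if_bounded[OF G1_sub, where c = "C * graph_norm As f"])
      (auto simp: graph_norm_nonneg)
  moreover have "extension f y = 0" if "y \<notin> G1" for y using that G1 by (simp add: extension_def)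
  ultimately show ?thesis using lin by (simp add: antidual_def)
qed

lemma ext_continuous_extension: "continuous_extension A T \<Gamma>0 G1 N extension"
  unfolding continuous_extension_def
proof (intro conjI ballI)
  show "extension ` Domain As \<subseteq> antidual G1 N" using ext_antidual by blast
  obtain C where C: "0 < C" "\<And>f y. f \<in> Domain As \<Longrightarrow> y \<in> G1 \<Longrightarrow> cmod (extension f y) \<le> C * graph_norm As f * N y"
    by (rule ext_bound) (rule that)
  have "functional_norm G1 N (extension f) \<le> C * graph_norm As f" if f: "f \<in> Domain As" for f
    using functional_norm_le[OF G1_sub N _ C(2)[OF f]] C(1) by (simp add: graph_norm_nonneg)
  then show "norm_continuous_on (Domain As) (graph_norm As) (functional_norm G1 N) extension"
    using C(1) clinear_on_diff[OF Domain_As clinear_ext]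
    by (intro norm_continuous_on_if_bounded[OF Domain_As, where c = C]) auto
  fix f assume f: "f \<in> Domain T"
  then have f': "f \<in> Domain As" using T_sub by blast
  show "extension f = antidual_embed G1 (\<Gamma>0 f)"
  proof
    fix y show "extension f y = antidual_embed G1 (\<Gamma>0 f) y"
    proof (cases "y \<in> G1")
      case True
      then obtain u where "u \<in> ker_on T \<Gamma>0" "y = \<Gamma>1 u" using G1 by blast
      then show ?thesis using True ext_\<Gamma>1[OF f'] bform_T[OF f] by (simp add: antidual_embed_def)
    next
      case False
      then show ?thesis using G1 by (simp add: extension_def antidual_embed_def)
    qed
  qed
qed

text \<open>Every \<open>\<phi>\<close> is attained on the eigenspace of \<open>A\<^sup>*\<close> at \<open>\<i>\<close>: the functional \<open>\<phi> \<circ> gamma_adj (- \<i>)\<close> on the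
  Hilbert space is represented by some \<open>z\<close>, and it vanishes on the range of \<open>A + \<i>\<close>, because
  \<open>\<Gamma>1\<close> vanishes on the domain of \<open>A\<close>. So \<open>z\<close> lies in this eigenspace.\<close>

lemma ext_surj:
  assumes \<phi>: "\<phi> \<in> antidual G1 N"
  obtains z where "z \<in> Domain As" "extension z = \<phi>"
proof -
  note gamma_adj_lin = clinear_gamma_adj[OF i_resolvent(2)] and gamma_adj_mem = gamma_adj_G1[OF i_resolvent(2)]
  have lin: "antilinear_on G1 \<phi>" and outside: "\<And>y. y \<notin> G1 \<Longrightarrow> \<phi> y = 0"
    using \<phi> by (auto simp: antidual_def)
  obtain c where c: "0 < c" "\<And>y. y \<in> G1 \<Longrightarrow> cmod (\<phi> y) \<le> c * N y"
    by (rule antidual_bounded[OF G1_sub N \<phi>]) (rule that)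
  obtain d where d: "0 < d" "\<And>h. N (gamma_adj (- \<i>) h) \<le> d * norm h"
    using gamma_adj_N_bound[OF i_resolvent(2)] by blast
  define f where "f h = cnj (\<phi> (gamma_adj (- \<i>) h))" for h
  have f_lin: "clinear_on UNIV f"
    using clinear_on_add[OF gamma_adj_lin] clinear_on_scaleC[OF gamma_adj_lin]
      antilinear_on_add[OF lin gamma_adj_mem gamma_adj_mem] antilinear_on_scaleC[OF lin gamma_adj_mem]
    by (simp add: clinear_on_def f_def scaleC_complex_def)
  have f_bound: "cmod (f h) \<le> (c * d) * norm h" for h
  proof -
    have "cmod (f h) \<le> c * N (gamma_adj (- \<i>) h)" using c(2)[OF gamma_adj_mem] by (simp add: f_def)
    also have "\<dots> \<le> c * (d * norm h)" using c(1) d(2) by (intro mult_left_mono) auto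
    finally show ?thesis by simp
  qed
  have cd: "0 \<le> c * d" using c(1) d(1) by simp
  obtain z where z: "\<forall>h\<in>UNIV. f h = cinner h z"
    by (rule riesz_representation[OF complex_vector.subspace_UNIV f_lin f_bound cd]) (rule that)
  have \<phi>_gamma_adj: "\<phi> (gamma_adj (- \<i>) h) = cinner z h" for h
  proof -
    have "cnj (f h) = cnj (cinner h z)" using z by simp
    then show ?thesis by (simp add: f_def flip: cinner_commute)
  qed
  have "cinner a' z = cinner a (\<i> *\<^sub>C z)" if a: "(a, a') \<in> A" for a a'
  proof -
    note bv = A_boundary_values[OF a]
    have "gamma_adj (- \<i>) (a' + \<i> *\<^sub>C a) = 0"
      using resolvent_shift[OF i_resolvent(2), of a] bv by (simp add: Domain_A0 app_A0 gamma_adj_def)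
    moreover have "\<phi> 0 = 0"
      using antilinear_on_scaleC[OF lin complex_vector.subspace_0[OF G1_sub], of 0] by simp
    ultimately have "cinner z (a' + \<i> *\<^sub>C a) = 0" using \<phi>_gamma_adj[of "a' + \<i> *\<^sub>C a"] by simp
    then have "cinner (a' + \<i> *\<^sub>C a) z = 0" by (subst cinner_commute) simp
    then show ?thesis by (simp add: cinner_simps add_eq_0_iff)
  qed
  then have z_As: "(z, \<i> *\<^sub>C z) \<in> As" by (auto simp: adjoint_op_def)
  then have z_dom: "z \<in> Domain As" by blast
  have "extension z y = \<phi> y" for y
  proof (cases "y \<in> G1")
    case True
    then obtain h where h: "y = gamma_adj (- \<i>) h" using range_gamma_adj[OF i_resolvent(2)] G1 by blast
    let ?u = "resolvent A0 (- \<i>) h"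
    have "extension z y = bform z ?u"
      using ext_\<Gamma>1[OF z_dom resolvent_ker[OF i_resolvent(2)], of h] by (simp add: h gamma_adj_def)
    also have "\<dots> = cinner z h"
      using app_eq[OF single_valued_As z_As] app_T_resolvent[OF i_resolvent(2)]
      by (simp add: bform_def cinner_simps)
    finally show ?thesis by (simp add: \<phi>_gamma_adj h)
  next
    case False
    then show ?thesis using outside G1 by (simp add: extension_def)
  qed
  then have "extension z = \<phi>" by blast
  with z_dom show thesis by (rule that)
qed

lemma continuous_extension_unique:
  assumes F: "continuous_extension A T \<Gamma>0 G1 N F" and F': "continuous_extension A T \<Gamma>0 G1 N F'"
    and f: "f \<in> Domain As"
  shows "F' f = F f"
proof
  fix y
  have mem: "F g \<in> antidual G1 N" "F' g \<in> antidual G1 N" if "g \<in> Domain As" for g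
    using that F F' by (auto simp: continuous_extension_def)
  obtain g where g: "\<And>n. g n \<in> Domain T" "g \<longlonglongrightarrow> f" "(\<lambda>n. app T (g n)) \<longlonglongrightarrow> app As f"
    by (rule Domain_T_graph_dense[OF f]) (rule that)
  have gs: "g n \<in> Domain As" for n using g(1) T_sub by blast
  have "(\<lambda>n. norm (g n - f, app T (g n) - app As f)) \<longlonglongrightarrow> norm (f - f, app As f - app As f)"
    by (intro tendsto_intros g)
  moreover have "graph_norm As (g n - f) = norm (g n - f, app T (g n) - app As f)" for n
    using clinear_on_diff[OF Domain_As clinear_on_app[OF linear_As] gs f] app_As_T[OF g(1)]
    by (simp add: graph_norm_app)
  ultimately have graph_lim: "(\<lambda>n. graph_norm As (g n - f)) \<longlonglongrightarrow> 0" by simp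
  show "F' f y = F f y"
  proof (cases "y \<in> G1")
    case y: True
    have lim: "(\<lambda>n. H (g n) y) \<longlonglongrightarrow> H f y" if H: "continuous_extension A T \<Gamma>0 G1 N H" for H
    proof (rule LIMSEQ_I)
      fix r :: real assume r: "0 < r"
      define e where "e = r / (N y + 1)"
      have Ny: "0 \<le> N y" by (rule is_norm_on_nonneg[OF N y])
      have e: "e > 0" using r Ny by (simp add: e_def)
      have H_mem: "H k \<in> antidual G1 N" if "k \<in> Domain As" for k
        using that H by (auto simp: continuous_extension_def)
      have "norm_continuous_on (Domain As) (graph_norm As) (functional_norm G1 N) H"
        using H by (simp add: continuous_extension_def)
      then obtain d where d: "d > 0"
        "\<forall>k\<in>Domain As. graph_norm As (k - f) < d \<longrightarrow> functional_norm G1 N (H k - H f) < e"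
        using f e unfolding norm_continuous_on_def by blast
      obtain n0 where n0: "\<And>n. n \<ge> n0 \<Longrightarrow> graph_norm As (g n - f) < d"
        using LIMSEQ_D[OF graph_lim d(1)] by (auto simp: graph_norm_nonneg)
      have "norm (H (g n) y - H f y) < r" if "n \<ge> n0" for n
      proof -
        have "cmod ((H (g n) - H f) y) \<le> functional_norm G1 N (H (g n) - H f) * N y"
          by (intro functional_norm_bound[OF G1_sub N _ y] antidual_diff[OF G1_sub N] H_mem gs f)
        also have "\<dots> \<le> e * N y"
          using d(2)[rule_format, OF gs n0[OF that]] Ny by (intro mult_right_mono) auto
        also have "\<dots> < r" using r Ny by (simp add: e_def field_simps)
        finally show ?thesis by simp
      qed
      then show "\<exists>n0. \<forall>n\<ge>n0. norm (H (g n) y - H f y) < r" by blast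
    qed
    have "F' (g n) = F (g n)" for n using F F' g(1) by (simp add: continuous_extension_def)
    then show ?thesis using lim[OF F] LIMSEQ_unique[OF lim[OF F']] by simp
  next
    case False
    then show ?thesis using mem[OF f] by (simp add: antidual_def)
  qed
qed

end

theorem proposition2p10:
  fixes A T A0 :: "('h::chilbert_space, 'h) graph"
    and \<Gamma>0 \<Gamma>1 :: "'h \<Rightarrow> 'g::chilbert_space"
    and G1 :: "'g set"
    and N :: "'g \<Rightarrow> real"
  assumes separable: "\<exists>D :: 'h set. countable D \<and> closure D = UNIV"
    and A: "linear_operator A" "closed A" "densely_defined A" "symmetric_op A"
    and triple: "quasi_boundary_triple A T \<Gamma>0 \<Gamma>1"
    and A0: "A0 = restrict_to_ker T \<Gamma>0"
    and G1: "G1 = \<Gamma>1 ` ker_on T \<Gamma>0"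
    and dense: "closure G1 = UNIV"
    and i_banach: "reflexive_banach_on G1 N"
    and i_embedded: "norm_continuous_on G1 N norm (\<lambda>x. x)"
    and ii: "\<exists>\<mu>\<in>resolvent_set A0. norm_continuous_on UNIV norm N (\<lambda>h. \<Gamma>1 (resolvent A0 (cnj \<mu>) h))"
  shows
    "(\<forall>\<mu>\<in>resolvent_set A0. norm_continuous_on UNIV norm N (\<lambda>h. \<Gamma>1 (resolvent A0 (cnj \<mu>) h)))
     \<and> (\<exists>F. continuous_extension A T \<Gamma>0 G1 N F
          \<and> clinear_on (Domain (adjoint_op A)) F
          \<and> F ` Domain (adjoint_op A) = antidual G1 N
          \<and> (\<forall>F'. continuous_extension A T \<Gamma>0 G1 N F'
                \<longrightarrow> (\<forall>f\<in>Domain (adjoint_op A). F' f = F f)))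
     \<and> equivalent_norms_on G1 N (induced_norm (Lambda_inner T \<Gamma>0 \<Gamma>1))"
proof -
  interpret quasi_triple_norm A T \<Gamma>0 \<Gamma>1 G1 N
    using A(3) triple G1 dense i_banach i_embedded ii
    by unfold_locales (auto simp: A0 reflexive_banach_on_def)
  show ?thesis
  proof (intro conjI)
    show "\<forall>\<mu>\<in>resolvent_set A0. norm_continuous_on UNIV norm N (\<lambda>h. \<Gamma>1 (resolvent A0 (cnj \<mu>) h))"
      unfolding A0 using gamma_adj_N_continuous by blast
    have "extension ` Domain (adjoint_op A) = antidual G1 N"
    proof
      show "extension ` Domain (adjoint_op A) \<subseteq> antidual G1 N" using ext_antidual by blast
      show "antidual G1 N \<subseteq> extension ` Domain (adjoint_op A)"
      proof
        fix \<phi> assume "\<phi> \<in> antidual G1 N"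
        then show "\<phi> \<in> extension ` Domain (adjoint_op A)" by (rule ext_surj) blast
      qed
    qed
    moreover have "\<forall>F'. continuous_extension A T \<Gamma>0 G1 N F' \<longrightarrow>
        (\<forall>f\<in>Domain (adjoint_op A). F' f = extension f)"
      using continuous_extension_unique[OF ext_continuous_extension] by blast
    ultimately show "\<exists>F. continuous_extension A T \<Gamma>0 G1 N F
        \<and> clinear_on (Domain (adjoint_op A)) F
        \<and> F ` Domain (adjoint_op A) = antidual G1 N
        \<and> (\<forall>F'. continuous_extension A T \<Gamma>0 G1 N F'
              \<longrightarrow> (\<forall>f\<in>Domain (adjoint_op A). F' f = F f))"
      using ext_continuous_extension clinear_ext by (intro exI[of _ extension] conjI)
    show "equivalent_norms_on G1 N (induced_norm (Lambda_inner T \<Gamma>0 \<Gamma>1))"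
      by (rule Lambda_norm_equivalent)
  qed
qed

end
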